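(* There exists a bijection $\varphi:\mathcal{P}_c\rightarrow\mathcal{W}_f$ characterized by the equality $$(J_{\varphi(x)}, I_{\varphi(x)})=(D_x, U_x[-1])\quad\text{for all }x\in\mathcal{P}_c.$$ Its inverse bijection $\psi:\mathcal{W}_f\rightarrow\mathcal{P}_c$ is therefore characterized by the equality $$(D_{\psi(w)}, U_{\psi(w)})=(J_w, I_w[1])\quad\text{for all }w\in\mathcal{W}_f.$$
   Context: Let $n\ge 1$, $\mathcal{W}=\mathfrak{S}_{n+1}$, $s_i=(i,i+1)$, $\mathcal{S}=\{s_1,\dots,s_n\}$, $\mathcal{T}$ the set of all transpositions; $\ell_{\mathcal{S}}$ and $\ell_{\mathcal{T}}$ are the word lengths with respect to $\mathcal{S}$ and $\mathcal{T}$. Permutations are composed from right to left, so $c:=s_1s_2\cdots s_n=(1,2,\dots,n+1)$. For $A\subset\mathbb{Z}$ and $m\in\mathbb{Z}$, $A[m]:=\{a+m\mid a\in A\}$. Fully commutative elements: $w\in\mathcal{W}$ is fully commutative if any two reduced $\mathcal{S}$-decompositions of $w$ are related by a sequence of relations $st=ts$ with $s,t\in\mathcal{S}$. $\mathcal{W}_f$ is the set of fully commutative elements. Every $w\in\mathcal{W}_f$ has a unique reduced $\mathcal{S}$-decomposition of the form $(s_{i_1}s_{i_1-1}\cdots s_{j_1})(s_{i_2}s_{i_2-1}\cdots s_{j_2})\cdots(s_{i_\ell}s_{i_\ell-1}\cdots s_{j_\ell})$ with all indices in $\{1,\dots,n\}$, $i_1<\dots<i_\ell$, $j_1<\dots<j_\ell$,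 $j_m\le i_m$ for all $m$. Set $I_w:=\{i_1,\dots,i_\ell\}$ and $J_w:=\{j_1,\dots,j_\ell\}$. Noncrossing partitions: $u<_{\mathcal{T}}v$ means $\ell_{\mathcal{T}}(u)+\ell_{\mathcal{T}}(u^{-1}v)=\ell_{\mathcal{T}}(v)$ (equality $u=v$ allowed), and $\mathcal{P}_c:=\{x\in\mathcal{W}\mid x<_{\mathcal{T}}c\}$. Each $x\in\mathcal{P}_c$ is a product of disjoint cycles $(i_1,i_2,\dots,i_k)$ with $i_1<\dots<i_k$ whose supports are the non-singleton blocks of a noncrossing partition of $\{1,\dots,n+1\}$. Place points $1,\dots,n+1$ clockwise on a circle; each cycle with $k\geq 2$ is represented by the polygon $P=[i_1i_2\cdots i_k]$ with these vertices (a single edge counts as a polygon). $i_1$ is called initial and $i_k$ terminal. Let $\mathrm{Vert}(x)$ be the set of vertices of all polygons of $x$, $U_x:=\mathrm{Vert}(x)\setminus\{\text{initial vertices}\}$, $D_x:=\mathrm{Vert}(x)\setminus\{\text{terminal vertices}\}$. *)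

theory Defs
  imports "HOL-Combinatorics.Combinatorics" "HOL-Library.FuncSet"
begin

text \<open>The symmetric group on \<open>n + 1\<close> letters is realised as the set of permutations of
  \<^term>\<open>{1..int n + 1}\<close>. The letters are integers so that index sets can be shifted by
  negative amounts. Products are compositions from right to left.\<close>

definition sym_gp :: "nat \<Rightarrow> (int \<Rightarrow> int) set" where
  "sym_gp n = {w. w permutes {1..int n + 1}}"

definition simple_refl :: "int \<Rightarrow> int \<Rightarrow> int" where
  "simple_refl i = transpose i (i + 1)"

definition simple_refls :: "nat \<Rightarrow> (int \<Rightarrow> int) set" where
  "simple_refls n = simple_refl ` {1..int n}"

definition transpositions :: "nat \<Rightarrow> (int \<Rightarrow> int) set" where
  "transpositions n = {transpose a b | a b. 1 \<le> a \<and> a < b \<and> b \<le> int n + 1}"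

definition word_prod :: "(int \<Rightarrow> int) list \<Rightarrow> int \<Rightarrow> int" where
  "word_prod ws = foldr (\<circ>) ws id"

definition word_length :: "(int \<Rightarrow> int) set \<Rightarrow> (int \<Rightarrow> int) \<Rightarrow> nat" where
  "word_length G w = (LEAST k. \<exists>ws. set ws \<subseteq> G \<and> word_prod ws = w \<and> length ws = k)"

definition shift :: "int set \<Rightarrow> int \<Rightarrow> int set" where
  "shift A m = {a + m | a. a \<in> A}"


subsection \<open>Fully commutative elements\<close>

definition reduced_decomp :: "nat \<Rightarrow> (int \<Rightarrow> int) list \<Rightarrow> (int \<Rightarrow> int) \<Rightarrow> bool" where
  "reduced_decomp n ws w \<longleftrightarrow> set ws \<subseteq> simple_refls n \<and> word_prod ws = w \<and>
     length ws = word_length (simple_refls n) w"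

definition commutation_moves :: "nat \<Rightarrow> (int \<Rightarrow> int) list rel" where
  "commutation_moves n = {(us @ [s, t] @ vs, us @ [t, s] @ vs) | us s t vs.
     s \<in> simple_refls n \<and> t \<in> simple_refls n \<and> s \<circ> t = t \<circ> s}"

definition fully_comm :: "nat \<Rightarrow> (int \<Rightarrow> int) set" where
  "fully_comm n = {w \<in> sym_gp n. \<forall>ws ws'. reduced_decomp n ws w \<longrightarrow> reduced_decomp n ws' w \<longrightarrow>
     (ws, ws') \<in> (commutation_moves n)\<^sup>*}"

definition descending_run :: "int \<Rightarrow> int \<Rightarrow> (int \<Rightarrow> int) list" where
  "descending_run i j = map simple_refl (rev [j..i])"

definition normal_form :: "nat \<Rightarrow> (int \<Rightarrow> int) \<Rightarrow> int list \<Rightarrow> int list \<Rightarrow> bool" where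
  "normal_form n w is js \<longleftrightarrow>
     set is \<subseteq> {1..int n} \<and> set js \<subseteq> {1..int n} \<and>
     sorted_wrt (<) is \<and> sorted_wrt (<) js \<and> list_all2 (\<le>) js is \<and>
     reduced_decomp n (concat (map2 descending_run is js)) w"

text \<open>The next two sets are meaningful for fully commutative \<open>w\<close>, where the normal form exists
  and is unique.\<close>

definition I_set :: "nat \<Rightarrow> (int \<Rightarrow> int) \<Rightarrow> int set" where
  "I_set n w = set (fst (THE (is, js). normal_form n w is js))"

definition J_set :: "nat \<Rightarrow> (int \<Rightarrow> int) \<Rightarrow> int set" where
  "J_set n w = set (snd (THE (is, js). normal_form n w is js))"


subsection \<open>Noncrossing partitions\<close>

definition coxeter_elt :: "nat \<Rightarrow> int \<Rightarrow> int" where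
  "coxeter_elt n = word_prod (map simple_refl [1..int n])"

definition abs_le :: "nat \<Rightarrow> (int \<Rightarrow> int) \<Rightarrow> (int \<Rightarrow> int) \<Rightarrow> bool" where
  "abs_le n u v \<longleftrightarrow> word_length (transpositions n) u + word_length (transpositions n) (inv u \<circ> v)
     = word_length (transpositions n) v"

definition NC :: "nat \<Rightarrow> (int \<Rightarrow> int) set" where
  "NC n = {x \<in> sym_gp n. abs_le n x (coxeter_elt n)}"

text \<open>A polygon is represented by its vertex set, the support of a cycle of length at least two.
  For \<open>x \<in> NC n\<close> each cycle is \<open>(i\<^sub>1, \<dots>, i\<^sub>k)\<close> with \<open>i\<^sub>1 < \<dots> < i\<^sub>k\<close>, so the initial vertex
  \<open>i\<^sub>1\<close> is the minimum and the terminal vertex \<open>i\<^sub>k\<close> the maximum of the polygon.\<close>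

definition polygons :: "(int \<Rightarrow> int) \<Rightarrow> int set set" where
  "polygons x = {orbit x i | i. x i \<noteq> i}"

definition Vert :: "(int \<Rightarrow> int) \<Rightarrow> int set" where
  "Vert x = \<Union> (polygons x)"

definition U_set :: "(int \<Rightarrow> int) \<Rightarrow> int set" where
  "U_set x = Vert x - Min ` polygons x"

definition D_set :: "(int \<Rightarrow> int) \<Rightarrow> int set" where
  "D_set x = Vert x - Max ` polygons x"

end

theory Submission
  imports Defs
begin

text \<open>
  The proof rests on one statistic. Call \<open>k\<close> an excedance of a permutation \<open>w\<close> if \<open>k < w k\<close>. In a
  noncrossing partition every cycle climbs through its block and then drops once from the maximum to
  the minimum, so its excedances are exactly the nonterminal vertices and the excedance values are
  exactly the noninitial ones (\<open>D_U_set_eq\<close>). A fully commutative \<open>w\<close> with run data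
  \<open>i\<^sub>1 < \<dots> < i\<^sub>l\<close>, \<open>j\<^sub>1 < \<dots> < j\<^sub>l\<close> sends \<open>j\<^sub>m\<close> to \<open>i\<^sub>m + 1\<close> and moves no other letter up, so its
  excedances are \<open>J\<^sub>w\<close> and its excedance values are \<open>I\<^sub>w[1]\<close> (\<open>excedances_runs\<close>). Hence both
  families are to be compared with the pairs \<open>(D, I)\<close> of equinumerous subsets of \<open>{1..n}\<close> for which the \<open>m\<close>-th
  smallest element of \<open>D\<close> is at most the \<open>m\<close>-th smallest element of \<open>I\<close>, and the theorem says that
  each such pair comes from exactly one noncrossing partition and from exactly one fully commutative
  element. The required bijection is the composition of the two (\<open>bij_betw_NC\<close>,
  \<open>bij_betw_fully_comm\<close>), and its characterization is injectivity of the two maps to pairs.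

  Noncrossing partitions. The absolute length of \<open>x\<close> is at least the number of its excedances, with
  equality iff every cycle has a single nonexcedance (\<open>transposition_length\<close>). For every permutation
  \<open>x\<close> the excedances of \<open>x\<close> and of \<open>x\<^sup>-\<^sup>1 c\<close> are \<open>n\<close> in total (\<open>excedances_complement\<close>), and \<open>c\<close> has
  absolute length \<open>n\<close>. So \<open>x\<close> is noncrossing iff \<open>x\<close> and \<open>x\<^sup>-\<^sup>1 c\<close> both have this property of their
  cycles (\<open>NC_iff_increasing_cycles\<close>). Given the excedances \<open>D\<close> and their values \<open>U\<close>, the smallest
  element \<open>u\<close> of \<open>U\<close> has to be the image of the largest element \<open>d\<close> of \<open>D\<close> below it, for otherwise two
  arcs would cross (\<open>innermost_arc\<close>). Multiplying by the transposition of \<open>d\<close> and \<open>u\<close> removes or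
  inserts this arc (\<open>remove_arc\<close>, \<open>add_arc\<close>), and induction gives existence and uniqueness
  (\<open>NC_unique_from_excedances\<close>).

  Fully commutative elements. A simple reflection raises the total upward displacement
  \<open>\<Sum>k. max 0 (w k - k)\<close> by at most one, so this number is a lower bound for the length; run words attain
  it, and words with a square or a braid as a factor do not. By appending letters one at a time, every
  word is commutation equivalent either to a run word or to a word with such a factor
  (\<open>word_contracts_or_normal_form\<close>). In a reduced word of a fully commutative element the second
  alternative is impossible, since a braid move changes the multiset of letters; in a reduced word of a
  product of runs it is impossible by the displacement. Hence the fully commutative elements are
  exactly the products of runs (\<open>fully_comm_iff_runs\<close>).
\<close>

section \<open>Words and their lengths\<close>

lemma word_prod_Nil [simp]: "word_prod [] = id"
  by (simp add: word_prod_def)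

lemma word_prod_Cons [simp]: "word_prod (t # ts) = t \<circ> word_prod ts"
  by (simp add: word_prod_def)

lemma word_prod_append [simp]: "word_prod (us @ vs) = word_prod us \<circ> word_prod vs"
  by (induction us) (simp_all add: comp_assoc)

lemma word_prod_permutes:
  assumes "\<And>t. t \<in> set ts \<Longrightarrow> t permutes S"
  shows "word_prod ts permutes S"
  using assms by (induction ts) (auto intro: permutes_compose)

lemma word_length_le:
  "set ws \<subseteq> G \<Longrightarrow> word_length G (word_prod ws) \<le> length ws"
  unfolding word_length_def by (rule Least_le) blast

lemma word_length_attained:
  assumes "set ws \<subseteq> G"
  obtains vs where "set vs \<subseteq> G" "word_prod vs = word_prod ws"
    "length vs = word_length G (word_prod ws)"
proof -
  have "\<exists>k vs. set vs \<subseteq> G \<and> word_prod vs = word_prod ws \<and> length vs = k"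
    using assms by blast
  from LeastI_ex[OF this] that show thesis
    unfolding word_length_def by blast
qed

lemma simple_refl_permutes: "i \<in> {1..int n} \<Longrightarrow> simple_refl i permutes {1..int n + 1}"
  unfolding simple_refl_def by (rule permutes_swap_id) auto

lemma transpositions_permute: "t \<in> transpositions n \<Longrightarrow> t permutes {1..int n + 1}"
  unfolding transpositions_def by (auto intro: permutes_swap_id)

lemma simple_refls_subset: "simple_refls n \<subseteq> transpositions n"
  unfolding simple_refls_def transpositions_def simple_refl_def by fastforce

text \<open>The lengths are defined by a least number, so a word has to be exhibited before anything is known
  about them. Conjugating the transposition of \<open>a\<close> and \<open>b\<close> by \<open>s\<^sub>b\<close> gives that of \<open>a\<close> and \<open>b + 1\<close>.\<close>
lemma simple_words_exist:
  assumes "w permutes {1..int n + 1}"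
  obtains ks where "set ks \<subseteq> {1..int n}" "w = word_prod (map simple_refl ks)"
proof -
  have transp: "\<exists>ks. set ks \<subseteq> {1..int n} \<and> transpose a (a + 1 + int m) = word_prod (map simple_refl ks)"
    if "1 \<le> a" "a + int m \<le> int n" for a m
    using that
  proof (induction m)
    case 0
    then show ?case by (intro exI[of _ "[a]"]) (auto simp: simple_refl_def)
  next
    case (Suc m)
    then obtain ks where ks: "set ks \<subseteq> {1..int n}"
      "transpose a (a + 1 + int m) = word_prod (map simple_refl ks)" by auto
    let ?b = "a + 1 + int m"
    have "transpose a (?b + 1) = simple_refl ?b \<circ> transpose a ?b \<circ> simple_refl ?b"
      by (auto simp: fun_eq_iff simple_refl_def transpose_def)
    also have "\<dots> = word_prod (map simple_refl ([?b] @ ks @ [?b]))"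
      using ks(2) by (simp add: comp_assoc)
    finally have "transpose a (?b + 1) = word_prod (map simple_refl ([?b] @ ks @ [?b]))" .
    moreover have "a + 1 + int (Suc m) = ?b + 1" by simp
    moreover have "set ([?b] @ ks @ [?b]) \<subseteq> {1..int n}" using ks(1) Suc.prems by auto
    ultimately show ?case by metis
  qed
  have "\<exists>ks. set ks \<subseteq> {1..int n} \<and> w = word_prod (map simple_refl ks)"
    using assms finite_atLeastAtMost_int
  proof (induction rule: permutes_induct)
    case id
    show ?case by (intro exI[of _ "[]"]) simp
  next
    case (swap a b p)
    have "\<exists>ks. set ks \<subseteq> {1..int n} \<and> transpose a b = word_prod (map simple_refl ks)"
    proof -
      have "transpose a b = transpose (min a b) (min a b + 1 + int (nat (max a b - min a b - 1)))"
        using swap(3) by (auto simp: min_def max_def transpose_commute)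
      then show ?thesis
        using transp[of "min a b" "nat (max a b - min a b - 1)"] swap(1-3) by auto
    qed
    then obtain ks where ks: "set ks \<subseteq> {1..int n}" "transpose a b = word_prod (map simple_refl ks)"
      by blast
    from swap obtain ls where ls: "set ls \<subseteq> {1..int n}" "p = word_prod (map simple_refl ls)"
      by blast
    show ?case
      by (intro exI[of _ "ks @ ls"]) (use ks ls in auto)
  qed
  with that show thesis by blast
qed

lemma coxeter_elt_apply:
  "coxeter_elt n k = (if k = int n + 1 then 1 else if 1 \<le> k \<and> k \<le> int n then k + 1 else k)"
proof (induction n arbitrary: k)
  case 0
  then show ?case by (simp add: coxeter_elt_def)
next
  case (Suc n)
  have "coxeter_elt (Suc n) = coxeter_elt n \<circ> simple_refl (int n + 1)"
    unfolding coxeter_elt_def by (simp add: upto_rec2[of 1 "1 + int n"] add.commute)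
  then show ?case by (auto simp: Suc simple_refl_def transpose_def)
qed

section \<open>Excedances and absolute length\<close>

definition excedances :: "(int \<Rightarrow> int) \<Rightarrow> int set" where
  "excedances x = {k. k < x k}"

lemma excedances_subset:
  assumes "x permutes {1..int n + 1}"
  shows "excedances x \<subseteq> {1..int n}" "x ` excedances x \<subseteq> {2..int n + 1}"
proof -
  have "k \<in> {1..int n} \<and> x k \<in> {2..int n + 1}" if "k < x k" for k
  proof -
    have "k \<in> {1..int n + 1}" using that permutes_not_in[OF assms, of k] by fastforce
    moreover have "x k \<in> {1..int n + 1}" using calculation permutes_in_image[OF assms] by blast
    ultimately show ?thesis using that by auto
  qed
  then show "excedances x \<subseteq> {1..int n}" "x ` excedances x \<subseteq> {2..int n + 1}"
    by (auto simp: excedances_def)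
qed

lemma finite_excedances: "x permutes {1..int n + 1} \<Longrightarrow> finite (excedances x)"
  using excedances_subset(1) finite_subset by blast

text \<open>A partition of the letters into unions of cycles is encoded by a labelling that is constant on
  cycles. Labellings are more flexible than orbits: cutting a letter out of a cycle means changing one
  value, and merging two cycles means identifying two labels.\<close>
definition class_fun :: "int set \<Rightarrow> (int \<Rightarrow> int) \<Rightarrow> (int \<Rightarrow> int) \<Rightarrow> bool" where
  "class_fun S x g \<longleftrightarrow> (\<forall>k\<in>S. g (x k) = g k)"

text \<open>A class always contains a nonexcedance, namely its maximum. Injectivity on the nonexcedances therefore
  forces each class to be a single cycle of the form \<open>(i\<^sub>1, \<dots>, i\<^sub>k)\<close> with \<open>i\<^sub>1 < \<dots> < i\<^sub>k\<close>.\<close>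
definition incr_class_fun :: "int set \<Rightarrow> (int \<Rightarrow> int) \<Rightarrow> (int \<Rightarrow> int) \<Rightarrow> bool" where
  "incr_class_fun S x g \<longleftrightarrow> class_fun S x g \<and> inj_on g {k \<in> S. x k \<le> k}"

definition increasing_cycles :: "int set \<Rightarrow> (int \<Rightarrow> int) \<Rightarrow> bool" where
  "increasing_cycles S x \<longleftrightarrow> (\<exists>g. incr_class_fun S x g)"

text \<open>The maximum of a class cannot be moved up.\<close>
lemma class_has_descent:
  assumes "finite S" "x permutes S" "class_fun S x g" "a \<in> S"
  obtains m where "m \<in> S" "g m = g a" "x m \<le> m" "a \<le> m"
proof -
  let ?C = "{k \<in> S. g k = g a}"
  have fin: "finite ?C" "a \<in> ?C" using assms by auto
  then have m: "Max ?C \<in> ?C" using Max_in by blast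
  have "x (Max ?C) \<in> ?C"
    using m assms(3) permutes_in_image[OF assms(2)] by (auto simp: class_fun_def)
  then have "x (Max ?C) \<le> Max ?C" using fin by simp
  with m fin that[of "Max ?C"] show thesis by auto
qed

lemma descent_is_max:
  assumes "finite S" "x permutes S" "incr_class_fun S x g"
    and "k \<in> S" "x k \<le> k" "a \<in> S" "g a = g k"
  shows "a \<le> k"
proof -
  from assms(3) have "class_fun S x g" by (simp add: incr_class_fun_def)
  from class_has_descent[OF assms(1,2) this \<open>a \<in> S\<close>]
  obtain m where m: "m \<in> S" "g m = g a" "x m \<le> m" "a \<le> m" .
  then have "m = k" using assms unfolding incr_class_fun_def inj_on_def by auto
  with m show ?thesis by simp
qed

lemma class_fun_inv:
  assumes "x permutes S" "class_fun S x g" "k \<in> S"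
  shows "g (inv x k) = g k"
proof -
  have "inv x k \<in> S" using assms permutes_inv permutes_in_image by metis
  then have "g (x (inv x k)) = g (inv x k)" using assms(2) unfolding class_fun_def by blast
  then show ?thesis using permutes_inverses[OF assms(1)] by simp
qed

text \<open>The minimum of a class is the image of some nonexcedance, and there is only one nonexcedance in the
  class.\<close>
lemma inv_descent_is_min:
  assumes "finite S" "x permutes S" "incr_class_fun S x g"
    and "k \<in> S" "k \<le> inv x k" "a \<in> S" "g a = g k"
  shows "k \<le> a"
proof -
  have cf: "class_fun S x g" using assms(3) by (simp add: incr_class_fun_def)
  let ?C = "{i \<in> S. g i = g a}"
  have fin: "finite ?C" "a \<in> ?C" using assms by auto
  define m where "m = Min ?C"
  have m: "m \<in> ?C" "m \<le> a" using fin Min_in[of ?C] unfolding m_def by auto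
  have inS: "inv x i \<in> S" if "i \<in> S" for i
    using that permutes_in_image[OF permutes_inv[OF assms(2)]] by blast
  have "inv x m \<in> ?C" using m inS class_fun_inv[OF assms(2) cf] by auto
  then have "m \<le> inv x m" using fin unfolding m_def by simp
  moreover have "g (inv x m) = g (inv x k)"
    using m assms class_fun_inv[OF assms(2) cf] by auto
  moreover have "inv x m \<in> S" "inv x k \<in> S" using m inS assms(4) by auto
  ultimately have "inv x m = inv x k"
    using assms(3,5) permutes_inverses[OF assms(2)]
    unfolding incr_class_fun_def inj_on_def by auto
  then have "m = k" using permutes_inverses[OF assms(2)] by metis
  with m show ?thesis by simp
qed

text \<open>Start with singleton classes; each further transposition merges at most two of them. So a word of
  length \<open>r\<close> leaves at least \<open>n + 1 - r\<close> classes.\<close>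
lemma class_fun_of_word:
  assumes "set ts \<subseteq> transpositions n"
  shows "\<exists>g. class_fun {1..int n + 1} (word_prod ts) g \<and> n + 1 \<le> card (g ` {1..int n + 1}) + length ts"
  using assms
proof (induction ts)
  case Nil
  show ?case by (intro exI[of _ id]) (simp add: class_fun_def)
next
  case (Cons t ts)
  let ?S = "{1..int n + 1}"
  from Cons obtain g where g: "class_fun ?S (word_prod ts) g"
    "n + 1 \<le> card (g ` ?S) + length ts" by auto
  from Cons.prems obtain a b where t: "t = transpose a b" "a \<in> ?S" "b \<in> ?S"
    by (auto simp: transpositions_def)
  define g' where "g' = (\<lambda>k. if g k = g b then g a else g k)"
  have "g' (t k) = g' k" for k by (auto simp: g'_def t(1) transpose_def)
  moreover have "g' (word_prod ts k) = g' k" if "k \<in> ?S" for k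
    using g(1) that by (simp add: class_fun_def g'_def)
  ultimately have "class_fun ?S (word_prod (t # ts)) g'"
    by (simp add: class_fun_def)
  moreover have "g ` ?S \<subseteq> insert (g b) (g' ` ?S)"
    by (auto simp: g'_def image_iff)
  then have "card (g ` ?S) \<le> card (insert (g b) (g' ` ?S))" by (intro card_mono) auto
  then have "card (g ` ?S) \<le> card (g' ` ?S) + 1"
    by (auto simp: card_insert_if split: if_splits)
  ultimately show ?case using g(2) by (intro exI[of _ g'] conjI) (simp_all add: comp_def)
qed

lemma card_descents:
  assumes "x permutes {1..int n + 1}"
  shows "card {k \<in> {1..int n + 1}. x k \<le> k} + card (excedances x) = n + 1"
proof -
  let ?S = "{1..int n + 1}"
  have "excedances x \<subseteq> ?S" using excedances_subset(1)[OF assms] by auto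
  then have "{k \<in> ?S. x k \<le> k} = ?S - excedances x" by (auto simp: excedances_def)
  moreover have "card (?S - excedances x) = card ?S - card (excedances x)"
    using \<open>excedances x \<subseteq> ?S\<close> by (intro card_Diff_subset finite_excedances[OF assms])
  moreover have "card (excedances x) \<le> card ?S"
    using \<open>excedances x \<subseteq> ?S\<close> by (intro card_mono) auto
  ultimately show ?thesis by auto
qed

text \<open>Every class contains a nonexcedance, so a product of \<open>r\<close> transpositions has at least \<open>n + 1 - r\<close>
  nonexcedances. If there are no more than that, then each class contains only one.\<close>
lemma excedances_le_length:
  assumes "set ts \<subseteq> transpositions n"
  shows "card (excedances (word_prod ts)) \<le> length ts"
    and "length ts = card (excedances (word_prod ts)) \<Longrightarrow>
      increasing_cycles {1..int n + 1} (word_prod ts)"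
proof -
  let ?S = "{1..int n + 1}" and ?x = "word_prod ts"
  let ?N = "{k \<in> ?S. ?x k \<le> k}"
  have perm: "?x permutes ?S"
    using assms by (intro word_prod_permutes transpositions_permute) auto
  obtain g where g: "class_fun ?S ?x g" "n + 1 \<le> card (g ` ?S) + length ts"
    using class_fun_of_word[OF assms] by blast
  have "g ` ?S \<subseteq> g ` ?N"
  proof
    fix c assume "c \<in> g ` ?S"
    then obtain a where a: "a \<in> ?S" "c = g a" by blast
    from class_has_descent[OF finite_atLeastAtMost_int perm g(1) a(1)]
    obtain m where "m \<in> ?S" "g m = g a" "?x m \<le> m" by metis
    with a show "c \<in> g ` ?N" by (intro image_eqI[of _ _ m]) auto
  qed
  moreover have finN: "finite ?N" by (rule finite_subset[of _ ?S]) auto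
  ultimately have "card (g ` ?S) \<le> card (g ` ?N)" by (intro card_mono finite_imageI)
  moreover have "card (g ` ?N) \<le> card ?N" using finN by (rule card_image_le)
  moreover note card_descents[OF perm] g(2)
  ultimately have le: "card (excedances ?x) \<le> length ts"
    and eq: "length ts = card (excedances ?x) \<Longrightarrow> card (g ` ?N) = card ?N" by linarith+
  show "card (excedances ?x) \<le> length ts" by (rule le)
  show "increasing_cycles ?S ?x" if "length ts = card (excedances ?x)"
  proof -
    have "inj_on g ?N" using finN eq[OF that] by (rule eq_card_imp_inj_on)
    then show ?thesis using g(1) unfolding increasing_cycles_def incr_class_fun_def by blast
  qed
qed

lemma no_excedances_imp_id:
  assumes "x permutes S" "increasing_cycles S x" "excedances x = {}"
  shows "x = id"
proof -
  from assms(2) obtain g where g: "incr_class_fun S x g" by (auto simp: increasing_cycles_def)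
  have le: "x k \<le> k" for k using assms(3) by (auto simp: excedances_def not_less[symmetric])
  have "x k = k" for k
  proof (cases "k \<in> S")
    case True
    then have "x k \<in> S" using permutes_in_image[OF assms(1)] by blast
    with True g le show ?thesis
      unfolding incr_class_fun_def class_fun_def inj_on_def by blast
  qed (use permutes_not_in[OF assms(1)] in blast)
  then show ?thesis by auto
qed

text \<open>The image \<open>u\<close> of the largest excedance \<open>d\<close> is the maximum of its cycle. Multiplying by the
  transposition of \<open>d\<close> and \<open>u\<close> splits \<open>u\<close> off as a fixed point and makes \<open>d\<close> the new maximum, which costs
  exactly one excedance.\<close>
lemma short_word_of_increasing_cycles:
  assumes "x permutes {1..int n + 1}" "increasing_cycles {1..int n + 1} x"
  shows "\<exists>ts. set ts \<subseteq> transpositions n \<and> word_prod ts = x \<and> length ts = card (excedances x)"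
  using assms
proof (induction "card (excedances x)" arbitrary: x)
  case 0
  then have "excedances x = {}" using finite_excedances by auto
  then have "x = id" using 0 no_excedances_imp_id by blast
  then show ?case by (intro exI[of _ "[]"]) (simp add: excedances_def)
next
  case (Suc r)
  let ?S = "{1..int n + 1}"
  from Suc obtain g where g: "class_fun ?S x g" "inj_on g {k \<in> ?S. x k \<le> k}"
    by (auto simp: increasing_cycles_def incr_class_fun_def)
  have inj: "x a = x b \<longleftrightarrow> a = b" for a b using permutes_inj[OF Suc(3)] by (auto dest: injD)
  define d where "d = Max (excedances x)"
  define u where "u = x d"
  define x' where "x' = x \<circ> transpose d u"
  have ne: "excedances x \<noteq> {}" "finite (excedances x)"
    using Suc(2) finite_excedances[OF Suc(3)] by auto
  then have "d \<in> excedances x" unfolding d_def by simp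
  then have du: "d < u" by (simp add: excedances_def u_def)
  have dmax: "x k \<le> k" if "d < k" for k
  proof (rule ccontr)
    assume "\<not> x k \<le> k"
    then have "k \<in> excedances x" by (simp add: excedances_def)
    with ne(2) that show False unfolding d_def by (meson Max_ge leD)
  qed
  have dS: "d \<in> ?S" using excedances_subset(1)[OF Suc(3)] \<open>d \<in> excedances x\<close> by auto
  have uS: "u \<in> ?S" using dS permutes_in_image[OF Suc(3)] unfolding u_def by blast
  have xuS: "x u \<in> ?S" using uS permutes_in_image[OF Suc(3)] by blast
  have xu_ne: "x u \<noteq> u" using inj[of u d] du unfolding u_def by auto
  \<comment> \<open>Otherwise \<open>u\<close> and \<open>x u\<close> would both be nonexcedances of the same cycle.\<close>
  have xu: "x u \<le> d"
  proof (rule ccontr)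
    assume "\<not> x u \<le> d"
    then have "x (x u) \<le> x u" "x u \<le> u" using dmax du by auto
    moreover have "g (x u) = g u" using g(1) uS by (simp add: class_fun_def)
    ultimately show False using g(2) uS xuS xu_ne unfolding inj_on_def by blast
  qed
  have x'_d: "x' d = x u" and x'_u: "x' u = u" by (simp_all add: x'_def u_def)
  have x'_other: "x' k = x k" if "k \<noteq> d" "k \<noteq> u" for k
    using that by (simp add: x'_def)
  have tr: "transpose d u \<in> transpositions n" using dS uS du by (auto simp: transpositions_def)
  have perm': "x' permutes ?S"
    unfolding x'_def using Suc(3) transpositions_permute[OF tr] by (rule permutes_compose[rotated])
  have exc': "excedances x' = excedances x - {d}"
  proof -
    have "k \<in> excedances x' \<longleftrightarrow> k \<in> excedances x - {d}" for k
      using x'_d x'_u x'_other[of k] xu dmax[of u] du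
      by (cases "k = d"; cases "k = u") (auto simp: excedances_def)
    then show ?thesis by blast
  qed
  then have card': "r = card (excedances x')"
    using Suc(2) \<open>d \<in> excedances x\<close> ne(2) by simp
  obtain c where c: "c \<notin> g ` ?S" using ex_new_if_finite[of "g ` ?S"] by auto
  \<comment> \<open>\<open>u\<close> is now a cycle of its own and gets the fresh label \<open>c\<close>.\<close>
  define g' where "g' = g(u := c)"
  have xk_u: "x k = u \<longleftrightarrow> k = d" for k using inj[of k d] by (simp add: u_def)
  have gxd: "g (x u) = g d"
  proof -
    have "g (x u) = g u" "g u = g d" using g(1) dS uS by (auto simp: class_fun_def u_def)
    then show ?thesis by simp
  qed
  have "class_fun ?S x' g'"
  proof (unfold class_fun_def, intro ballI)
    fix k assume k: "k \<in> ?S"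
    show "g' (x' k) = g' k"
    proof (cases "k = d \<or> k = u")
      case True
      then show ?thesis using x'_d x'_u gxd xu_ne du by (auto simp: g'_def)
    next
      case False
      then show ?thesis using x'_other[of k] xk_u[of k] g(1) k by (auto simp: g'_def class_fun_def)
    qed
  qed
  moreover have "inj_on g' {k \<in> ?S. x' k \<le> k}"
  proof (rule inj_onI)
    have *: "k \<noteq> u \<Longrightarrow> k \<in> ?S \<Longrightarrow> x' k \<le> k \<Longrightarrow> k = d \<or> x k \<le> k" for k
      using x'_other[of k] by (cases "k = d") auto
    have gd: "a = d" if "a \<in> ?S" "a \<noteq> u" "x' a \<le> a" "g a = g d" for a
    proof (rule ccontr)
      assume "a \<noteq> d"
      then have "x a \<le> a" using * that by blast
      moreover have "g d = g u" using g(1) dS by (simp add: class_fun_def u_def)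
      moreover have "x u \<le> u" using dmax du by blast
      ultimately show False using g(2) that uS unfolding inj_on_def by auto
    qed
    fix a b assume "a \<in> {k \<in> ?S. x' k \<le> k}" "b \<in> {k \<in> ?S. x' k \<le> k}" "g' a = g' b"
    then have ab: "a \<in> ?S" "b \<in> ?S" "x' a \<le> a" "x' b \<le> b" "g' a = g' b" by auto
    show "a = b"
    proof (cases "a = u \<or> b = u")
      case True
      then show ?thesis using ab c by (auto simp: g'_def split: if_splits)
    next
      case False
      then have "g a = g b" using ab by (simp add: g'_def)
      moreover have "a = d \<or> x a \<le> a" "b = d \<or> x b \<le> b" using False ab * by blast+
      ultimately show ?thesis using False ab gd[of a] gd[of b] g(2) unfolding inj_on_def by auto
    qed
  qed
  ultimately have "increasing_cycles ?S x'" by (auto simp: increasing_cycles_def incr_class_fun_def)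
  from Suc(1)[OF card' perm' this] obtain ts where ts: "set ts \<subseteq> transpositions n"
    "word_prod ts = x'" "length ts = card (excedances x')" by blast
  have "word_prod (ts @ [transpose d u]) = x"
    using ts(2) by (simp add: x'_def comp_assoc)
  moreover have "length (ts @ [transpose d u]) = card (excedances x)"
    using ts(3) card' Suc(2) by simp
  ultimately show ?case using ts(1) tr
    by (intro exI[of _ "ts @ [transpose d u]"]) auto
qed

lemma shortest_transposition_word:
  assumes "x permutes {1..int n + 1}"
  obtains ts where "set ts \<subseteq> transpositions n" "word_prod ts = x"
    "length ts = word_length (transpositions n) x"
proof -
  obtain ks where ks: "set ks \<subseteq> {1..int n}" "x = word_prod (map simple_refl ks)"
    using simple_words_exist[OF assms] .
  then have "set (map simple_refl ks) \<subseteq> transpositions n"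
    using simple_refls_subset[of n] by (auto simp: simple_refls_def)
  from word_length_attained[OF this] that show thesis using ks(2) by metis
qed

lemma transposition_length:
  assumes "x permutes {1..int n + 1}"
  shows "card (excedances x) \<le> word_length (transpositions n) x"
    and "word_length (transpositions n) x = card (excedances x) \<longleftrightarrow>
      increasing_cycles {1..int n + 1} x"
proof -
  obtain ts where ts: "set ts \<subseteq> transpositions n" "word_prod ts = x"
    "length ts = word_length (transpositions n) x"
    using shortest_transposition_word[OF assms] .
  then show le: "card (excedances x) \<le> word_length (transpositions n) x"
    using excedances_le_length(1) by metis
  show "word_length (transpositions n) x = card (excedances x) \<longleftrightarrow>
      increasing_cycles {1..int n + 1} x"
    using ts excedances_le_length(2)[OF ts(1)] short_word_of_increasing_cycles[OF assms] le
      word_length_le by (metis le_antisym)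
qed

lemma transposition_length_comp:
  assumes "y permutes {1..int n + 1}" "t \<in> transpositions n"
  shows "word_length (transpositions n) (y \<circ> t) \<le> word_length (transpositions n) y + 1"
proof -
  obtain ts where ts: "set ts \<subseteq> transpositions n" "word_prod ts = y"
    "length ts = word_length (transpositions n) y"
    using shortest_transposition_word[OF assms(1)] .
  have "word_length (transpositions n) (word_prod (ts @ [t])) \<le> length (ts @ [t])"
    using ts(1) assms(2) by (intro word_length_le) auto
  then show ?thesis using ts(2,3) by simp
qed

lemma coxeter_elt_permutes: "coxeter_elt n permutes {1..int n + 1}"
  unfolding coxeter_elt_def by (rule word_prod_permutes) (auto intro!: simple_refl_permutes)

lemma transposition_length_coxeter_elt: "word_length (transpositions n) (coxeter_elt n) = n"
proof -
  have "excedances (coxeter_elt n) = {1..int n}"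
    by (auto simp: excedances_def coxeter_elt_apply split: if_splits)
  then have "n \<le> word_length (transpositions n) (coxeter_elt n)"
    using transposition_length(1)[OF coxeter_elt_permutes, of n] by simp
  moreover have "set (map simple_refl [1..int n]) \<subseteq> transpositions n"
    using simple_refls_subset by (fastforce simp: simple_refls_def)
  from word_length_le[OF this]
  have "word_length (transpositions n) (coxeter_elt n) \<le> n" by (simp add: coxeter_elt_def)
  ultimately show ?thesis by simp
qed

text \<open>The map \<open>k \<mapsto> x\<^sup>-\<^sup>1 (k + 1)\<close> turns an excedance \<open>k\<close> of \<open>x\<^sup>-\<^sup>1 c\<close> into a nonexcedance of \<open>x\<close>. Only the
  preimage of \<open>1\<close>, which is always a nonexcedance, is missed.\<close>
lemma excedances_complement:
  assumes "x permutes {1..int n + 1}"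
  shows "card (excedances x) + card (excedances (inv x \<circ> coxeter_elt n)) = n"
proof -
  let ?S = "{1..int n + 1}" and ?y = "inv x \<circ> coxeter_elt n"
  let ?N = "{k \<in> ?S. x k \<le> k}"
  note inv = permutes_inverses[OF assms]
  have iperm: "inv x permutes ?S" using permutes_inv[OF assms] .
  have yperm: "?y permutes ?S" using coxeter_elt_permutes iperm by (rule permutes_compose)
  have "bij_betw (\<lambda>k. inv x (k + 1)) (excedances ?y) (?N - {inv x 1})"
  proof (rule bij_betw_byWitness[where f' = "\<lambda>j. x j - 1"])
    show "\<forall>k\<in>excedances ?y. x (inv x (k + 1)) - 1 = k" by (simp add: inv)
    show "\<forall>j\<in>?N - {inv x 1}. inv x (x j - 1 + 1) = j" by (simp add: inv)
    show "(\<lambda>k. inv x (k + 1)) ` excedances ?y \<subseteq> ?N - {inv x 1}"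
    proof safe
      fix k assume k: "k \<in> excedances ?y"
      then have k1: "k \<in> {1..int n}" using excedances_subset(1)[OF yperm] by blast
      then have c: "coxeter_elt n k = k + 1" by (simp add: coxeter_elt_apply)
      from k1 have "k + 1 \<in> ?S" by auto
      then show "inv x (k + 1) \<in> ?S" using permutes_in_image[OF iperm] by blast
      show "x (inv x (k + 1)) \<le> inv x (k + 1)" using k c inv by (simp add: excedances_def)
      assume "inv x (k + 1) = inv x 1"
      then have "k + 1 = 1" using inv by metis
      with k1 show False by simp
    qed
    show "(\<lambda>j. x j - 1) ` (?N - {inv x 1}) \<subseteq> excedances ?y"
    proof (rule image_subsetI)
      fix j assume "j \<in> ?N - {inv x 1}"
      then have j: "j \<in> ?S" "x j \<le> j" "j \<noteq> inv x 1" by auto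
      have "x j \<in> ?S" using j permutes_in_image[OF assms] by blast
      moreover have "x j \<noteq> 1" using j(3) inv by metis
      ultimately have "coxeter_elt n (x j - 1) = x j" by (auto simp: coxeter_elt_apply)
      then show "x j - 1 \<in> excedances ?y" using j inv by (simp add: excedances_def)
    qed
  qed
  then have "card (excedances ?y) = card (?N - {inv x 1})" by (rule bij_betw_same_card)
  moreover have "inv x 1 \<in> ?N"
    using permutes_in_image[OF iperm, of 1] inv by auto
  moreover have "finite ?N" by (rule finite_subset[of _ ?S]) auto
  ultimately have "card (excedances ?y) + 1 = card ?N"
    using card_Suc_Diff1[of ?N "inv x 1"] by simp
  then show ?thesis using card_descents[OF assms] by linarith
qed

text \<open>Both lengths in the definition of \<open>x <\<^sub>T c\<close> are bounded below by excedance numbers whose sum is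
  already the length \<open>n\<close> of \<open>c\<close>, so the defining equality holds iff both bounds are attained.\<close>
lemma NC_iff_increasing_cycles:
  "x \<in> NC n \<longleftrightarrow> x permutes {1..int n + 1} \<and> increasing_cycles {1..int n + 1} x \<and>
     increasing_cycles {1..int n + 1} (inv x \<circ> coxeter_elt n)"
proof (cases "x permutes {1..int n + 1}")
  case True
  let ?y = "inv x \<circ> coxeter_elt n"
  have y: "?y permutes {1..int n + 1}"
    using coxeter_elt_permutes permutes_inv[OF True] by (rule permutes_compose)
  show ?thesis
    using transposition_length[OF True] transposition_length[OF y] excedances_complement[OF True] True
    by (auto simp: NC_def sym_gp_def abs_le_def transposition_length_coxeter_elt)
qed (simp add: NC_def sym_gp_def)

section \<open>Polygons and excedances\<close>

lemma constant_on_interval: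
  fixes h :: "int \<Rightarrow> 'a"
  assumes "a \<le> b" "\<And>k. a \<le> k \<Longrightarrow> k < b \<Longrightarrow> h (k + 1) = h k"
  shows "h b = h a"
  using assms
proof (induction b rule: int_ge_induct)
  case (step i)
  then have "h i = h a" by simp
  moreover have "h (i + 1) = h i" using step by simp
  ultimately show ?case by simp
qed simp

lemma not_excedance_value_iff:
  assumes "x permutes S"
  shows "k \<notin> x ` excedances x \<longleftrightarrow> k \<le> inv x k"
proof -
  have "k \<in> x ` excedances x \<longleftrightarrow> inv x k \<in> excedances x"
  proof
    assume "inv x k \<in> excedances x"
    then show "k \<in> x ` excedances x"
      using permutes_inverses(1)[OF assms, of k] by (intro image_eqI[of _ _ "inv x k"]) auto
  qed (use permutes_inverses(2)[OF assms] in auto)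
  then show ?thesis using permutes_inverses[OF assms] by (auto simp: excedances_def)
qed

lemma fixed_point_of_increasing_cycles:
  assumes "finite S" "x permutes S" "increasing_cycles S x" "k \<notin> excedances x" "k \<notin> x ` excedances x"
  shows "x k = k"
proof (cases "k \<in> S")
  case True
  from assms(3) obtain g where g: "incr_class_fun S x g" by (auto simp: increasing_cycles_def)
  have "x k \<in> S" using True permutes_in_image[OF assms(2)] by blast
  moreover have "g (x k) = g k" using g True by (auto simp: incr_class_fun_def class_fun_def)
  moreover have "k \<le> inv x k" using assms(5) not_excedance_value_iff[OF assms(2)] by blast
  ultimately have "k \<le> x k" using inv_descent_is_min[OF assms(1,2) g True] by blast
  with assms(4) show ?thesis by (auto simp: excedances_def)
qed (use permutes_not_in[OF assms(2)] in blast)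

lemma Vert_eq:
  assumes "permutation x"
  shows "Vert x = {k. x k \<noteq> k}"
proof -
  note self = permutation_self_in_orbit[OF assms]
  have "x k \<noteq> k" if "k \<in> orbit x i" "x i \<noteq> i" for k i
  proof
    assume "x k = k"
    then have "orbit x k \<subseteq> {k}" by (auto elim: orbit.induct)
    moreover have "i \<in> orbit x k" using orbit_swap[OF self that(1)] .
    ultimately show False using \<open>x k = k\<close> that(2) by blast
  qed
  then show ?thesis using self by (auto simp: Vert_def polygons_def)
qed

text \<open>In an increasing cycle the terminal vertex is the only nonexcedance, and the initial vertex is the only
  value of a nonexcedance.\<close>
lemma D_U_set_eq:
  assumes "finite S" "x permutes S" "increasing_cycles S x"
  shows "D_set x = excedances x" "U_set x = x ` excedances x"
proof -
  have perm: "permutation x" using permutes_imp_permutation[OF assms(1,2)] .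
  note self = permutation_self_in_orbit[OF perm]
  note inv = permutes_inverses[OF assms(2)]
  from assms(3) obtain g where g: "incr_class_fun S x g" by (auto simp: increasing_cycles_def)
  have vS: "i \<in> S" if "x i \<noteq> i" for i using that permutes_not_in[OF assms(2), of i] by blast
  have stepS: "x a \<in> S \<and> g (x a) = g a" if "a \<in> S" for a
    using that g permutes_in_image[OF assms(2)] by (simp add: incr_class_fun_def class_fun_def)
  have orb: "a \<in> S \<and> g a = g i" if "a \<in> orbit x i" "i \<in> S" for a i
    using that(1)
  proof (induction rule: orbit.induct)
    case base
    then show ?case using stepS[OF that(2)] .
  next
    case (step a)
    then show ?case using stepS[of a] by simp
  qed
  have fin: "finite (orbit x i)" for i by (rule finite_orbit[OF self])
  have inv_orb: "inv x a \<in> orbit x i" if "a \<in> orbit x i" for a i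
    using that by (cases rule: orbit.cases) (simp_all add: inv self)
  have D: "k \<in> Max ` polygons x \<longleftrightarrow> k \<notin> excedances x" if k: "x k \<noteq> k" for k
  proof
    assume "k \<in> Max ` polygons x"
    then obtain i where i: "k = Max (orbit x i)" by (auto simp: polygons_def)
    then have "k \<in> orbit x i" using Max_in[OF fin orbit_nonempty] by simp
    then have "x k \<in> orbit x i" by (rule orbit.step)
    then show "k \<notin> excedances x" using Max_ge[OF fin, of "x k" i] i by (simp add: excedances_def)
  next
    assume "k \<notin> excedances x"
    then have "x k \<le> k" by (simp add: excedances_def)
    then have "a \<le> k" if "a \<in> orbit x k" for a
      using descent_is_max[OF assms(1,2) g vS[OF k]] orb[OF that vS[OF k]] by blast
    then have "Max (orbit x k) = k" using fin self by (intro Max_eqI) auto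
    moreover have "orbit x k \<in> polygons x" using k by (auto simp: polygons_def)
    ultimately show "k \<in> Max ` polygons x" by (intro image_eqI[of _ _ "orbit x k"]) auto
  qed
  have U: "k \<in> Min ` polygons x \<longleftrightarrow> k \<notin> x ` excedances x" if k: "x k \<noteq> k" for k
  proof
    assume "k \<in> Min ` polygons x"
    then obtain i where i: "k = Min (orbit x i)" by (auto simp: polygons_def)
    then have "inv x k \<in> orbit x i" using Min_in[OF fin orbit_nonempty] inv_orb by simp
    then have "k \<le> inv x k" using Min_le[OF fin] i by blast
    then show "k \<notin> x ` excedances x" using not_excedance_value_iff[OF assms(2)] by blast
  next
    assume "k \<notin> x ` excedances x"
    then have "k \<le> inv x k" using not_excedance_value_iff[OF assms(2)] by blast
    then have "k \<le> a" if "a \<in> orbit x k" for a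
      using inv_descent_is_min[OF assms(1,2) g vS[OF k]] orb[OF that vS[OF k]] by blast
    then have "Min (orbit x k) = k" using fin self by (intro Min_eqI) auto
    moreover have "orbit x k \<in> polygons x" using k by (auto simp: polygons_def)
    ultimately show "k \<in> Min ` polygons x" by (intro image_eqI[of _ _ "orbit x k"]) auto
  qed
  have "x k \<noteq> k" if "k \<in> excedances x" for k using that by (auto simp: excedances_def)
  then show "D_set x = excedances x" using D unfolding D_set_def Vert_eq[OF perm] by blast
  have "x k \<noteq> k" if "k \<in> x ` excedances x" for k
  proof -
    from that obtain d where "d < x d" "k = x d" by (auto simp: excedances_def)
    then show ?thesis using injD[OF permutes_inj[OF assms(2)], of k d] by auto
  qed
  then show "U_set x = x ` excedances x" using U unfolding U_set_def Vert_eq[OF perm] by blast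
qed

section \<open>Dominance of finite sets of integers\<close>

text \<open>Counting form of: the \<open>m\<close>-th smallest element of \<open>D\<close> is strictly below the \<open>m\<close>-th smallest element
  of \<open>U\<close>, for every \<open>m\<close>. Removing elements is easier to follow in counts than in sorted lists.\<close>
definition dominates :: "int set \<Rightarrow> int set \<Rightarrow> bool" where
  "dominates U D \<longleftrightarrow> finite D \<and> finite U \<and> card D = card U \<and>
     (\<forall>t. card {u \<in> U. u \<le> t} \<le> card {d \<in> D. d < t})"

lemma dominates_if_bij:
  assumes "finite D" "inj_on f D" "\<And>d. d \<in> D \<Longrightarrow> d < f d"
  shows "dominates (f ` D) D"
proof -
  have "card {u \<in> f ` D. u \<le> t} \<le> card {d \<in> D. d < t}" for t
  proof -
    have "{u \<in> f ` D. u \<le> t} \<subseteq> f ` {d \<in> D. d < t}" using assms(3) by (auto simp: image_iff dest: less_le_trans)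
    then have "card {u \<in> f ` D. u \<le> t} \<le> card (f ` {d \<in> D. d < t})"
      using assms(1) by (intro card_mono) auto
    also have "\<dots> \<le> card {d \<in> D. d < t}" using assms(1) by (intro card_image_le) auto
    finally show ?thesis .
  qed
  then show ?thesis using assms by (simp add: dominates_def card_image)
qed

text \<open>The smallest element of \<open>U\<close> has elements of \<open>D\<close> below it. Matching it with the largest of these gives
  an arc with no further element of \<open>D\<close> or \<open>U\<close> underneath, and the remaining sets are still dominated.\<close>
lemma first_arc:
  assumes "dominates U D" "D \<noteq> {}"
  obtains d u where "d \<in> D" "u \<in> U" "d < u" "\<forall>v\<in>U. u \<le> v" "\<forall>i\<in>D. i < u \<longrightarrow> i \<le> d"
    "dominates (U - {u}) (D - {d})"
proof -
  have fin: "finite D" "finite U" and card: "card D = card U"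
    and dom: "card {u \<in> U. u \<le> t} \<le> card {d \<in> D. d < t}" for t
    using assms(1) by (auto simp: dominates_def)
  define u where "u = Min U"
  have "U \<noteq> {}" using card fin assms(2) by auto
  then have u: "u \<in> U" "\<forall>v\<in>U. u \<le> v" using fin by (auto simp: u_def)
  have "{v \<in> U. v \<le> u} = {u}" using u by force
  with dom[of u] have "{i \<in> D. i < u} \<noteq> {}" by force
  define d where "d = Max {i \<in> D. i < u}"
  have d: "d \<in> D" "d < u" using Max_in[OF _ \<open>{i \<in> D. i < u} \<noteq> {}\<close>] fin by (auto simp: d_def)
  have dmax: "\<forall>i\<in>D. i < u \<longrightarrow> i \<le> d" using fin by (auto simp: d_def)
  have "card {v \<in> U - {u}. v \<le> t} \<le> card {i \<in> D - {d}. i < t}" for t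
  proof (cases "u \<le> t")
    case True
    have "{v \<in> U - {u}. v \<le> t} = {v \<in> U. v \<le> t} - {u}" "{i \<in> D - {d}. i < t} = {i \<in> D. i < t} - {d}"
      by auto
    moreover have "u \<in> {v \<in> U. v \<le> t}" "d \<in> {i \<in> D. i < t}" using u d True by auto
    ultimately have "card {v \<in> U - {u}. v \<le> t} = card {v \<in> U. v \<le> t} - 1"
      "card {i \<in> D - {d}. i < t} = card {i \<in> D. i < t} - 1"
      by (simp_all only: card_Diff_singleton)
    then show ?thesis using dom[of t] by simp
  next
    case False
    then have "{v \<in> U - {u}. v \<le> t} = {}" using u by force
    then show ?thesis by (simp only: card.empty)
  qed
  then have "dominates (U - {u}) (D - {d})" using fin card u d by (simp add: dominates_def)
  with that[of d u] u d dmax show thesis by blast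
qed

section \<open>Noncrossing partitions from their excedances\<close>

text \<open>If \<open>u\<close> were the image of some \<open>e < d\<close>, the arcs from \<open>e\<close> to \<open>u\<close> and from \<open>i\<close> to \<open>x i\<close> would cross, where
  \<open>i\<close> is the first excedance after \<open>e\<close>. The contradiction arises in \<open>y = x\<^sup>-\<^sup>1 c\<close>: it sends \<open>u - 1\<close> down to
  \<open>e\<close>, then runs through the fixed points of \<open>x\<close> up to \<open>i - 1\<close>, and from there jumps to \<open>x\<^sup>-\<^sup>1 i\<close>, which is
  beyond \<open>u - 1\<close>. But \<open>u - 1\<close> is a nonexcedance of \<open>y\<close> and thus the maximum of its cycle.\<close>
lemma innermost_arc:
  assumes "x \<in> NC n" "d \<in> excedances x" "u \<in> x ` excedances x" "d < u"
    and u_min: "\<forall>v \<in> x ` excedances x. u \<le> v"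
    and d_max: "\<forall>i \<in> excedances x. i < u \<longrightarrow> i \<le> d"
  shows "x d = u"
proof (rule ccontr)
  assume "x d \<noteq> u"
  let ?S = "{1..int n + 1}" and ?y = "inv x \<circ> coxeter_elt n"
  from assms(1) have perm: "x permutes ?S" and icx: "increasing_cycles ?S x"
    and icy: "increasing_cycles ?S ?y" by (auto simp: NC_iff_increasing_cycles)
  have iperm: "inv x permutes ?S" using permutes_inv[OF perm] .
  have yperm: "?y permutes ?S" using coxeter_elt_permutes iperm by (rule permutes_compose)
  note inv = permutes_inverses[OF perm]
  note fin = finite_atLeastAtMost_int
  from icx obtain g where g: "incr_class_fun ?S x g" by (auto simp: increasing_cycles_def)
  from icy obtain h where h: "incr_class_fun ?S ?y h" by (auto simp: increasing_cycles_def)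
  have sub: "excedances x \<subseteq> {1..int n}" "x ` excedances x \<subseteq> {2..int n + 1}"
    using excedances_subset[OF perm] by auto
  have y: "?y k = inv x (k + 1)" if "1 \<le> k" "k \<le> int n" for k
    using that by (simp add: coxeter_elt_apply)
  have hy: "h (?y k) = h k" if "k \<in> ?S" for k
    using h that unfolding incr_class_fun_def class_fun_def by blast
  have gx: "g (x k) = g k" if "k \<in> ?S" for k
    using g that unfolding incr_class_fun_def class_fun_def by blast
  obtain e where e: "e \<in> excedances x" "x e = u" using assms(3) by blast
  then have "e < u" by (auto simp: excedances_def)
  then have "e \<le> d" "e \<noteq> d" using d_max e \<open>x d \<noteq> u\<close> by auto
  then have "e < d" by simp
  define i where "i = Min {i \<in> excedances x. e < i}"
  have fi: "finite {i \<in> excedances x. e < i}" "d \<in> {i \<in> excedances x. e < i}"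
    using finite_excedances[OF perm] assms(2) \<open>e < d\<close> by auto
  then have i: "i \<in> excedances x" "e < i" "i \<le> d"
    unfolding i_def using Min_in[OF fi(1)] Min_le[OF fi] by blast+
  have fixed: "x k = k" if "e < k" "k < i" for k
  proof (rule fixed_point_of_increasing_cycles[OF fin perm icx])
    show "k \<notin> excedances x" using that Min_le[OF fi(1), of k] unfolding i_def[symmetric] by auto
    show "k \<notin> x ` excedances x" using that i \<open>d < u\<close> u_min by force
  qed
  have range: "1 \<le> e" "i \<le> int n" "u \<le> int n + 1" "2 \<le> u" using e i sub assms(3) by auto
  have chain: "h (i - 1) = h e"
  proof (rule constant_on_interval[of e "i - 1" h])
    show "e \<le> i - 1" using i by simp
    fix k assume k: "e \<le> k" "k < i - 1"
    have "x (k + 1) = k + 1" using k by (intro fixed) auto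
    then have "inv x (k + 1) = k + 1" using inv(2)[of "k + 1"] by simp
    then have "?y k = k + 1" using y[of k] k range by simp
    then show "h (k + 1) = h k" using hy[of k] k range by auto
  qed
  define M where "M = inv x i"
  have xM: "x M = i" by (simp add: M_def inv)
  have iS: "i \<in> ?S" using i range by auto
  have MS: "M \<in> ?S" using iS permutes_in_image[OF iperm] unfolding M_def by blast
  have "i \<notin> x ` excedances x" using u_min i \<open>d < u\<close> by force
  then have "i \<le> M" using not_excedance_value_iff[OF perm] unfolding M_def by blast
  moreover have "x i \<in> ?S" using iS permutes_in_image[OF perm] by blast
  moreover have "g (x i) = g M" using gx[OF MS] gx[OF iS] xM by simp
  ultimately have "x i \<le> M" using descent_is_max[OF fin perm g MS] xM by auto
  \<comment> \<open>\<open>M\<close> is the maximum of the cycle of \<open>i\<close>, and \<open>x i\<close> is an excedance value.\<close>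
  then have "u \<le> M" using u_min i(1) by force
  have "?y (i - 1) = M" using y[of "i - 1"] i range by (simp add: M_def)
  then have "h M = h e" using hy[of "i - 1"] chain i range by auto
  moreover have yu: "?y (u - 1) = e" using y[of "u - 1"] range e(2) inv by auto
  then have "h (u - 1) = h e" using hy[of "u - 1"] range by auto
  ultimately have "M \<le> u - 1"
    using descent_is_max[OF fin yperm h, of "u - 1" M] MS yu \<open>e < u\<close> range by auto
  with \<open>u \<le> M\<close> show False by simp
qed

text \<open>Here \<open>d\<close> is the minimum of its cycle, and the product drops \<open>d\<close> from it. On the other side \<open>x\<^sup>-\<^sup>1 c\<close> is
  multiplied by a single transposition, so that its absolute length grows by at most one; its excedance
  number grows by exactly one, hence the lower bound for the length is still attained.\<close>
lemma remove_arc: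
  assumes "x \<in> NC n" "d \<in> excedances x" "x d = u" "d \<notin> x ` excedances x"
  defines "x' \<equiv> transpose d u \<circ> x"
  shows "x' \<in> NC n" "excedances x' = excedances x - {d}"
    "x' ` excedances x' = x ` excedances x - {u}"
proof -
  let ?S = "{1..int n + 1}"
  from assms(1) have perm: "x permutes ?S" and icx: "increasing_cycles ?S x"
    and icy: "increasing_cycles ?S (inv x \<circ> coxeter_elt n)" by (auto simp: NC_iff_increasing_cycles)
  have iperm: "inv x permutes ?S" using permutes_inv[OF perm] .
  have yperm: "inv x \<circ> coxeter_elt n permutes ?S"
    using coxeter_elt_permutes iperm by (rule permutes_compose)
  note inv = permutes_inverses[OF perm]
  note fin = finite_atLeastAtMost_int
  from icx obtain g where g: "incr_class_fun ?S x g" by (auto simp: increasing_cycles_def)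
  have gx: "g (x k) = g k" if "k \<in> ?S" for k
    using g that unfolding incr_class_fun_def class_fun_def by blast
  have inj: "x a = x b \<longleftrightarrow> a = b" for a b using permutes_inj[OF perm] by (auto dest: injD)
  have du: "d < u" using assms(2,3) by (simp add: excedances_def)
  have dS: "d \<in> ?S" "u \<in> ?S" using excedances_subset[OF perm] assms(2,3) by auto
  define z where "z = inv x d"
  have xz: "x z = d" by (simp add: z_def inv)
  have "z \<noteq> d" using xz assms(3) du by auto
  moreover have "d \<le> z" using assms(4) not_excedance_value_iff[OF perm] z_def by blast
  ultimately have dz: "d < z" by simp
  have zS: "z \<in> ?S" using dS permutes_in_image[OF iperm] unfolding z_def by blast
  have gz: "g z = g d" "g u = g d" using gx[OF zS] gx[OF dS(1)] xz assms(3) by auto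
  have uz: "u \<le> z" using descent_is_max[OF fin perm g zS _ dS(2)] gz xz dz by auto
  have x': "x' d = d" "x' z = u" using assms(3) xz by (auto simp: x'_def)
  have x'_other: "x' k = x k" if "k \<noteq> d" "k \<noteq> z" for k
    using that inj[of k d] inj[of k z] xz assms(3) by (auto simp: x'_def transpose_def)
  have tr: "transpose d u \<in> transpositions n" using dS du by (auto simp: transpositions_def)
  have perm': "x' permutes ?S"
    unfolding x'_def using perm transpositions_permute[OF tr] by (rule permutes_compose)
  have mem: "k \<in> excedances x' \<longleftrightarrow> k \<in> excedances x - {d}" for k
    using x' x'_other[of k] xz uz dz by (cases "k = d"; cases "k = z") (auto simp: excedances_def)
  then show exc': "excedances x' = excedances x - {d}" by blast
  have "x' k = x k" if "k \<in> excedances x - {d}" for k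
  proof -
    have "k \<noteq> z" using that xz dz by (auto simp: excedances_def)
    then show ?thesis using that x'_other[of k] by simp
  qed
  then have "x' ` excedances x' = x ` (excedances x - {d})" unfolding exc' by auto
  also have "\<dots> = x ` excedances x - {u}" using inj assms(2,3) by auto
  finally show "x' ` excedances x' = x ` excedances x - {u}" .
  have icx': "increasing_cycles ?S x'"
  proof -
    obtain c where c: "c \<notin> g ` ?S" using ex_new_if_finite[of "g ` ?S"] by auto
    \<comment> \<open>\<open>d\<close> is now a fixed point and gets the fresh label \<open>c\<close>.\<close>
    have "class_fun ?S x' (g(d := c))"
      unfolding class_fun_def
    proof
      fix k assume k: "k \<in> ?S"
      show "(g(d := c)) (x' k) = (g(d := c)) k"
        using x' x'_other[of k] gx[OF k] gz du dz inj[of k z] xz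
        by (cases "k = d"; cases "k = z") auto
    qed
    moreover have "inj_on (g(d := c)) {k \<in> ?S. x' k \<le> k}"
    proof (rule inj_onI)
      have desc: "x k \<le> k" if "x' k \<le> k" "k \<noteq> d" for k
        using that mem[of k] by (auto simp: excedances_def)
      fix a b assume "a \<in> {k \<in> ?S. x' k \<le> k}" "b \<in> {k \<in> ?S. x' k \<le> k}"
        "(g(d := c)) a = (g(d := c)) b"
      then have ab: "a \<in> ?S" "b \<in> ?S" "x' a \<le> a" "x' b \<le> b" "(g(d := c)) a = (g(d := c)) b"
        by auto
      show "a = b"
      proof (cases "a = d \<or> b = d")
        case True
        then show ?thesis using ab c by (auto split: if_splits)
      next
        case False
        then show ?thesis using ab desc g unfolding incr_class_fun_def inj_on_def by auto
      qed
    qed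
    ultimately show ?thesis by (auto simp: increasing_cycles_def incr_class_fun_def)
  qed
  let ?c = "coxeter_elt n"
  define t' where "t' = transpose (inv ?c d) (inv ?c u)"
  note cinv = permutes_inverses[OF coxeter_elt_permutes, of n]
  have icS: "inv ?c k \<in> ?S" if "k \<in> ?S" for k
    using that permutes_in_image[OF permutes_inv[OF coxeter_elt_permutes]] by blast
  have t': "t' \<in> transpositions n"
  proof -
    have "inv ?c d \<noteq> inv ?c u" using du cinv(1) by (metis less_irrefl)
    then have "min (inv ?c d) (inv ?c u) < max (inv ?c d) (inv ?c u)" by auto
    moreover have "t' = transpose (min (inv ?c d) (inv ?c u)) (max (inv ?c d) (inv ?c u))"
      by (auto simp: t'_def min_def max_def transpose_commute)
    ultimately show ?thesis using icS[OF dS(1)] icS[OF dS(2)] unfolding transpositions_def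
      by (intro CollectI exI[of _ "min (inv ?c d) (inv ?c u)"] exI[of _ "max (inv ?c d) (inv ?c u)"]) auto
  qed
  have "transpose d u \<circ> ?c = ?c \<circ> t'"
    using cinv by (auto simp: fun_eq_iff t'_def transpose_def) 
  moreover have "inv x' = inv x \<circ> transpose d u"
    unfolding x'_def using permutes_bij[OF perm] by (simp add: o_inv_distrib)
  ultimately have y': "inv x' \<circ> ?c = (inv x \<circ> ?c) \<circ> t'" by (metis comp_assoc)
  have yperm': "inv x' \<circ> ?c permutes ?S"
    using coxeter_elt_permutes permutes_inv[OF perm'] by (rule permutes_compose)
  have "card (excedances x') + 1 = card (excedances x)"
    using exc' assms(2) finite_excedances[OF perm] card_Suc_Diff1 by fastforce
  then have "word_length (transpositions n) (inv x' \<circ> ?c) \<le> card (excedances (inv x' \<circ> ?c))"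
    using transposition_length_comp[OF yperm t'] transposition_length(2)[OF yperm] icy
      excedances_complement[OF perm] excedances_complement[OF perm'] unfolding y' by linarith
  then have "increasing_cycles ?S (inv x' \<circ> ?c)"
    using transposition_length[OF yperm'] by simp
  with perm' icx' show "x' \<in> NC n" by (simp add: NC_iff_increasing_cycles)
qed

text \<open>The letters from \<open>d\<close> to \<open>u - 1\<close> are fixed points of \<open>x'\<close>, and \<open>u\<close> is the minimum of its cycle; the product
  puts \<open>d\<close> in front of \<open>u\<close>. In the complement, \<open>x'\<^sup>-\<^sup>1 c\<close> has the consecutive letters \<open>d, d + 1, \<dots>, u - 1\<close> in
  one cycle, and they are split off as an increasing cycle of their own.\<close>
lemma add_arc:
  assumes "x' \<in> NC n" "1 \<le> d" "d < u" "u \<le> int n + 1"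
    and D: "\<And>i. d \<le> i \<Longrightarrow> i < u \<Longrightarrow> i \<notin> excedances x'"
    and U: "\<And>i. d \<le> i \<Longrightarrow> i \<le> u \<Longrightarrow> i \<notin> x' ` excedances x'"
  defines "x \<equiv> transpose d u \<circ> x'"
  shows "x \<in> NC n" "excedances x = insert d (excedances x')"
    "x ` excedances x = insert u (x' ` excedances x')"
proof -
  let ?S = "{1..int n + 1}"
  let ?c = "coxeter_elt n"
  let ?y = "inv x \<circ> ?c" and ?y' = "inv x' \<circ> ?c"
  from assms(1) have perm': "x' permutes ?S" and icx': "increasing_cycles ?S x'"
    and icy': "increasing_cycles ?S ?y'" by (auto simp: NC_iff_increasing_cycles)
  have iperm': "inv x' permutes ?S" using permutes_inv[OF perm'] .
  note inv = permutes_inverses[OF perm']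
  note fin = finite_atLeastAtMost_int
  from icx' obtain g where g: "incr_class_fun ?S x' g" by (auto simp: increasing_cycles_def)
  have gx: "g (x' k) = g k" if "k \<in> ?S" for k
    using g that unfolding incr_class_fun_def class_fun_def by blast
  from icy' obtain h where h: "incr_class_fun ?S ?y' h" by (auto simp: increasing_cycles_def)
  have hy: "h (?y' k) = h k" if "k \<in> ?S" for k
    using h that unfolding incr_class_fun_def class_fun_def by blast
  have inj: "x' a = x' b \<longleftrightarrow> a = b" for a b using permutes_inj[OF perm'] by (auto dest: injD)
  have dS: "d \<in> ?S" "u \<in> ?S" using assms(2-4) by auto
  have fixed: "x' k = k" if "d \<le> k" "k < u" for k
    using fixed_point_of_increasing_cycles[OF fin perm' icx' D U] that by auto
  then have ifixed: "inv x' k = k" if "d \<le> k" "k < u" for k using that inv by metis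
  define z where "z = inv x' u"
  have x'z: "x' z = u" by (simp add: z_def inv)
  have zS: "z \<in> ?S" using dS permutes_in_image[OF iperm'] unfolding z_def by blast
  have uz: "u \<le> z" using U[of u] assms(3) not_excedance_value_iff[OF perm'] z_def by auto
  have x: "x d = u" "x z = d" using fixed[of d] x'z assms(3) by (auto simp: x_def)
  have x_other: "x k = x' k" if "k \<noteq> d" "k \<noteq> z" for k
    using that inj[of k d] inj[of k z] x'z fixed[of d] assms(3) by (auto simp: x_def transpose_def)
  have tr: "transpose d u \<in> transpositions n" using assms(2-4) by (auto simp: transpositions_def)
  have perm: "x permutes ?S"
    unfolding x_def using perm' transpositions_permute[OF tr] by (rule permutes_compose)
  have mem: "k \<in> excedances x \<longleftrightarrow> k \<in> insert d (excedances x')" for k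
    using x x_other[of k] x'z uz assms(3) by (cases "k = d"; cases "k = z") (auto simp: excedances_def)
  then show exc: "excedances x = insert d (excedances x')" by blast
  have "x k = x' k" if "k \<in> excedances x'" for k
  proof -
    have "k \<noteq> z" using that x'z uz by (auto simp: excedances_def)
    moreover have "k \<noteq> d" using that D[of d] assms(3) by auto
    ultimately show ?thesis using x_other[of k] by simp
  qed
  then show "x ` excedances x = insert u (x' ` excedances x')" using x(1) unfolding exc by auto
  have icx: "increasing_cycles ?S x"
  proof -
    have gz: "g z = g u" using gx[OF zS] x'z by simp
    have "class_fun ?S x (g(d := g u))"
      unfolding class_fun_def
    proof
      fix k assume k: "k \<in> ?S"
      show "(g(d := g u)) (x k) = (g(d := g u)) k"
        using x x_other[of k] gx[OF k] gz assms(3) uz inj[of k d] fixed[of d]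
        by (cases "k = d"; cases "k = z") auto
    qed
    moreover have "inj_on (g(d := g u)) {k \<in> ?S. x k \<le> k}"
    proof (rule inj_onI)
      have desc: "x' k \<le> k \<and> k \<noteq> d" if "x k \<le> k" for k
        using that mem[of k] by (auto simp: excedances_def)
      fix a b assume "a \<in> {k \<in> ?S. x k \<le> k}" "b \<in> {k \<in> ?S. x k \<le> k}"
        "(g(d := g u)) a = (g(d := g u)) b"
      then show "a = b" using desc[of a] desc[of b] g
        unfolding incr_class_fun_def inj_on_def by auto
    qed
    ultimately show ?thesis by (auto simp: increasing_cycles_def incr_class_fun_def)
  qed
  have "inv x = inv x' \<circ> transpose d u"
    unfolding x_def using permutes_bij[OF perm'] by (simp add: o_inv_distrib)
  then have y: "?y k = inv x' (transpose d u (?c k))" for k by simp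
  have c_inj: "?c a = ?c b \<longleftrightarrow> a = b" for a b
    using permutes_inj[OF coxeter_elt_permutes] by (auto dest: injD)
  have c_step: "?c k = k + 1" if "d \<le> k" "k < u" for k
    using that assms(2-4) by (simp add: coxeter_elt_apply)
  obtain c0 where c0: "c0 \<notin> h ` ?S" using ex_new_if_finite[of "h ` ?S"] by auto
  define h1 where "h1 = (\<lambda>k. if d \<le> k \<and> k < u then c0 else h k)"
  \<comment> \<open>The labelling \<open>h1\<close> gives the new cycle \<open>(d, d + 1, \<dots>, u - 1)\<close> of \<open>x\<^sup>-\<^sup>1 c\<close> a fresh label.\<close>
  have y_mid: "?y k = (if k = u - 1 then d else k + 1)" if "d \<le> k" "k < u" for k
    using y[of k] c_step[OF that] that ifixed[of d] ifixed[of "k + 1"] by auto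
  have y_other: "?y k = ?y' k" if "\<not> (d \<le> k \<and> k < u)" "?c k \<noteq> d" for k
  proof -
    have "?c k \<noteq> u" using that(1) c_inj[of k "u - 1"] c_step[of "u - 1"] assms(3) by auto
    then show ?thesis using that(2) y[of k] by simp
  qed
  have y_pre: "?y k = z" "?y' k = d" if "?c k = d" for k
    using that y[of k] ifixed[of d] assms(3) by (simp_all add: z_def)
  have c_pre: "\<not> (d \<le> k \<and> k < u)" if "?c k = d" for k using that c_step[of k] by force
  have hz: "h z = h k" if "?c k = d" "k \<in> ?S" for k
  proof -
    have "h (u - 1) = h d"
    proof (rule constant_on_interval[of d "u - 1" h])
      fix j assume j: "d \<le> j" "j < u - 1"
      then have "?y' j = j + 1" using c_step[of j] ifixed[of "j + 1"] by simp
      then show "h (j + 1) = h j" using hy[of j] j assms(2,4) by auto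
    qed (use assms(3) in simp)
    moreover have "?y' (u - 1) = z" using c_step[of "u - 1"] assms(3) by (simp add: z_def)
    then have "h z = h (u - 1)" using hy[of "u - 1"] assms(2-4) by auto
    moreover have "h d = h k" using hy[OF that(2)] y_pre(2)[OF that(1)] by simp
    ultimately show ?thesis by simp
  qed
  have icy: "increasing_cycles ?S ?y"
  proof -
    have "class_fun ?S ?y h1"
      unfolding class_fun_def
    proof
      fix k assume k: "k \<in> ?S"
      consider "d \<le> k" "k < u" | "?c k = d" | "\<not> (d \<le> k \<and> k < u)" "?c k \<noteq> d" by blast
      then show "h1 (?y k) = h1 k"
      proof cases
        case 1
        then show ?thesis using y_mid[OF 1] assms(3) by (simp add: h1_def split: if_splits)
      next
        case 2
        then show ?thesis using y_pre(1)[OF 2] c_pre[OF 2] hz[OF 2 k] uz unfolding h1_def by auto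
      next
        case 3
        have "\<not> (d \<le> ?y' k \<and> ?y' k < u)"
        proof
          assume a: "d \<le> ?y' k \<and> ?y' k < u"
          then have "?c k = ?y' k" using fixed[of "?y' k"] inv by auto
          then have "?c k = ?c (?c k - 1)" "d < ?c k" "?c k < u"
            using a 3(2) c_step[of "?y' k - 1"] by auto
          then have "k = ?c k - 1" using c_inj[of k "?c k - 1"] by blast
          then show False using 3(1) \<open>d < ?c k\<close> \<open>?c k < u\<close> by linarith
        qed
        then show ?thesis using y_other[OF 3] hy[OF k] 3(1) unfolding h1_def by auto
      qed
    qed
    moreover have "inj_on h1 {k \<in> ?S. ?y k \<le> k}"
    proof (rule inj_onI)
      have mid: "k = u - 1" if "d \<le> k \<and> k < u" "?y k \<le> k" for k
        using that y_mid[of k] by (auto split: if_splits)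
      have desc: "?y' k \<le> k" if "\<not> (d \<le> k \<and> k < u)" "?y k \<le> k" "k \<in> ?S" for k
      proof (cases "?c k = d")
        case True
        then show ?thesis using y_pre[OF True] that uz assms(3) by auto
      qed (use y_other that in auto)
      fix a b assume "a \<in> {k \<in> ?S. ?y k \<le> k}" "b \<in> {k \<in> ?S. ?y k \<le> k}" "h1 a = h1 b"
      then have ab: "a \<in> ?S" "b \<in> ?S" "?y a \<le> a" "?y b \<le> b" "h1 a = h1 b" by auto
      have "h a \<noteq> c0" "h b \<noteq> c0" using c0 ab by blast+
      then consider "d \<le> a \<and> a < u" "d \<le> b \<and> b < u"
        | "\<not> (d \<le> a \<and> a < u)" "\<not> (d \<le> b \<and> b < u)" "h a = h b"
        using ab(5) unfolding h1_def by (auto split: if_splits)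
      then show "a = b"
      proof cases
        case 1
        then show ?thesis using mid ab by metis
      next
        case 2
        then show ?thesis using desc ab h unfolding incr_class_fun_def inj_on_def by blast
      qed
    qed
    ultimately show ?thesis by (auto simp: increasing_cycles_def incr_class_fun_def)
  qed
  show "x \<in> NC n" using perm icx icy by (simp add: NC_iff_increasing_cycles)
qed

lemma id_in_NC: "id \<in> NC n"
proof -
  have "incr_class_fun {1..int n + 1} (coxeter_elt n) (\<lambda>_. 0)"
    unfolding incr_class_fun_def class_fun_def inj_on_def by (auto simp: coxeter_elt_apply split: if_splits)
  moreover have "incr_class_fun {1..int n + 1} id id" by (simp add: incr_class_fun_def class_fun_def)
  ultimately show ?thesis
    unfolding NC_iff_increasing_cycles increasing_cycles_def by (auto simp: permutes_id)
qed

text \<open>Induction on the number of arcs: the arc of \<open>first_arc\<close> is forced by \<open>innermost_arc\<close>, and taking it out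
  leaves a noncrossing partition that is unique by induction.\<close>
theorem NC_unique_from_excedances:
  assumes "dominates U D" "D \<subseteq> {1..int n}" "U \<subseteq> {2..int n + 1}"
  shows "\<exists>!x. x \<in> NC n \<and> excedances x = D \<and> x ` excedances x = U"
  using assms
proof (induction "card D" arbitrary: D U)
  case 0
  then have "D = {}" "U = {}" by (auto simp: dominates_def)
  have exc_id: "excedances id = {}" by (simp add: excedances_def)
  show ?case
  proof (rule ex1I[of _ id])
    show "id \<in> NC n \<and> excedances id = D \<and> id ` excedances id = U"
      using \<open>D = {}\<close> \<open>U = {}\<close> exc_id id_in_NC by simp
  next
    fix x assume "x \<in> NC n \<and> excedances x = D \<and> x ` excedances x = U"
    then show "x = id" using \<open>D = {}\<close> no_excedances_imp_id[of x "{1..int n + 1}"]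
      by (simp add: NC_iff_increasing_cycles)
  qed
next
  case (Suc r)
  then have "D \<noteq> {}" by auto
  from first_arc[OF Suc.prems(1) this] obtain d u where du: "d \<in> D" "u \<in> U" "d < u"
    "\<forall>v\<in>U. u \<le> v" "\<forall>i\<in>D. i < u \<longrightarrow> i \<le> d" "dominates (U - {u}) (D - {d})" by blast
  let ?t = "transpose d u"
  have "r = card (D - {d})" using Suc.hyps(2) du(1) Suc.prems(1) by (simp add: dominates_def)
  moreover have "D - {d} \<subseteq> {1..int n}" "U - {u} \<subseteq> {2..int n + 1}"
    using Suc.prems(2,3) by blast+
  ultimately have ex1: "\<exists>!x. x \<in> NC n \<and> excedances x = D - {d} \<and> x ` excedances x = U - {u}"
    using du(6) by (intro Suc.hyps(1))
  then obtain x' where x': "x' \<in> NC n" "excedances x' = D - {d}" "x' ` excedances x' = U - {u}"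
    by (elim ex1E conjE)
  show ?case
  proof (rule ex1I[of _ "?t \<circ> x'"])
    have "1 \<le> d" "u \<le> int n + 1" using du Suc.prems by auto
    note add_arc = add_arc[OF x'(1) this(1) du(3) this(2)]
    have D': "i \<notin> excedances x'" if "d \<le> i" "i < u" for i
    proof
      assume "i \<in> excedances x'"
      then have "i \<in> D" "i \<noteq> d" using x'(2) by auto
      moreover from this have "i \<le> d" using du(5) that(2) by blast
      ultimately show False using that(1) by simp
    qed
    have U': "i \<notin> x' ` excedances x'" if "d \<le> i" "i \<le> u" for i
    proof
      assume "i \<in> x' ` excedances x'"
      then have "i \<in> U" "i \<noteq> u" unfolding x'(3) by simp_all
      moreover from this have "u \<le> i" using du(4) by blast
      ultimately show False using that(2) by simp
    qed
    have "excedances (?t \<circ> x') = D"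
      using add_arc(2)[OF D' U'] unfolding x'(2) insert_Diff[OF du(1)] .
    moreover have "(?t \<circ> x') ` excedances (?t \<circ> x') = U"
      using add_arc(3)[OF D' U'] unfolding x'(3) insert_Diff[OF du(2)] .
    ultimately show "?t \<circ> x' \<in> NC n \<and> excedances (?t \<circ> x') = D \<and>
      (?t \<circ> x') ` excedances (?t \<circ> x') = U"
      using add_arc(1)[OF D' U'] by blast
  next
    fix x assume "x \<in> NC n \<and> excedances x = D \<and> x ` excedances x = U"
    then have x: "x \<in> NC n" "excedances x = D" "x ` excedances x = U" by blast+
    have xd: "x d = u"
      by (rule innermost_arc[OF x(1), of d u, unfolded x(3), unfolded x(2), OF du(1-5)])
    have d: "d \<notin> x ` excedances x" using du(3,4) unfolding x(3) by auto
    have "d \<in> excedances x" unfolding x(2) by (rule du(1))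
    note remove_arc = remove_arc[OF x(1) this xd d]
    have "?t \<circ> x = x'"
    proof (rule ex1E[OF ex1])
      fix w assume w: "\<forall>v. v \<in> NC n \<and> excedances v = D - {d} \<and> v ` excedances v = U - {u} \<longrightarrow> v = w"
      have "?t \<circ> x = w"
        using remove_arc(1) remove_arc(2)[unfolded x(2)] remove_arc(3)[unfolded x(3)]
        by (intro w[rule_format] conjI)
      moreover have "x' = w" using x' by (intro w[rule_format] conjI)
      ultimately show ?thesis by simp
    qed
    then have "?t \<circ> x' = (?t \<circ> ?t) \<circ> x" by (simp only: comp_assoc)
    then show "x = ?t \<circ> x'" by (simp add: id_def comp_def)
  qed
qed

section \<open>Displacement and contractible words\<close>

abbreviation simple_prod :: "int list \<Rightarrow> int \<Rightarrow> int" where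
  "simple_prod ks \<equiv> word_prod (map simple_refl ks)"

lemma simple_prod_permutes: "set ks \<subseteq> {1..int n} \<Longrightarrow> simple_prod ks permutes {1..int n + 1}"
  by (rule word_prod_permutes) (auto intro!: simple_refl_permutes)

text \<open>The upward half of the total displacement. It is the number of inversions exactly for the
  permutations without a decreasing subsequence of length three, and only a lower bound otherwise.\<close>
definition displacement :: "nat \<Rightarrow> (int \<Rightarrow> int) \<Rightarrow> nat" where
  "displacement n w = (\<Sum>k = 1..int n + 1. nat (w k - k))"

text \<open>Only the preimage of \<open>i\<close> has its value increased.\<close>
lemma displacement_transpose:
  assumes "w permutes {1..int n + 1}" "i < j"
  shows "displacement n (transpose i j \<circ> w) \<le> displacement n w + nat (j - i)"
proof -
  let ?S = "{1..int n + 1}"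
  note inv = permutes_inverses[OF assms(1)]
  have eq: "w k = i \<longleftrightarrow> k = inv w i" for k using inv(1)[of i] inv(2)[of k] by auto
  have "displacement n (transpose i j \<circ> w) \<le>
      (\<Sum>k \<in> ?S. nat (w k - k) + (if k = inv w i then nat (j - i) else 0))"
    unfolding displacement_def
  proof (rule sum_mono)
    fix k
    show "nat ((transpose i j \<circ> w) k - k) \<le> nat (w k - k) + (if k = inv w i then nat (j - i) else 0)"
      using assms(2) unfolding eq[symmetric] by (auto simp: transpose_def)
  qed
  also have "\<dots> \<le> displacement n w + nat (j - i)"
    by (simp add: sum.distrib displacement_def)
  finally show ?thesis .
qed

lemma displacement_append_le:
  assumes "set us \<subseteq> {1..int n}" "w permutes {1..int n + 1}"
  shows "displacement n (simple_prod us \<circ> w) \<le> length us + displacement n w"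
  using assms(1)
proof (induction us)
  case (Cons i us)
  have "simple_prod us \<circ> w permutes {1..int n + 1}"
    using assms(2) simple_prod_permutes[of us n] Cons.prems by (intro permutes_compose) auto
  from displacement_transpose[OF this, of i "i + 1"]
  have step: "displacement n (simple_refl i \<circ> (simple_prod us \<circ> w)) \<le> displacement n (simple_prod us \<circ> w) + 1"
    unfolding simple_refl_def[of i] by simp
  have eq: "simple_prod (i # us) \<circ> w = simple_refl i \<circ> (simple_prod us \<circ> w)"
    by (simp add: comp_assoc)
  have "displacement n (simple_prod us \<circ> w) \<le> length us + displacement n w"
    using Cons by (simp add: comp_def)
  with step show ?case unfolding eq list.size(4) by linarith
qed simp

lemma displacement_le_length:
  assumes "set ks \<subseteq> {1..int n}"
  shows "displacement n (simple_prod ks) \<le> length ks"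
proof -
  have "displacement n id = 0" by (simp add: displacement_def)
  with displacement_append_le[OF assms permutes_id] show ?thesis by simp
qed

text \<open>The two obstructions to being the reduced word of a fully commutative element: a square and a braid.\<close>
definition contractible :: "int list \<Rightarrow> bool" where
  "contractible ks \<longleftrightarrow> (\<exists>us vs s. ks = us @ [s, s] @ vs \<or>
     (\<exists>t. (t = s + 1 \<or> s = t + 1) \<and> ks = us @ [s, t, s] @ vs))"

lemma contractible_square: "contractible (us @ [s, s] @ vs)"
  unfolding contractible_def by blast

lemma contractible_braid: "t = s + 1 \<or> s = t + 1 \<Longrightarrow> contractible (us @ [s, t, s] @ vs)"
  unfolding contractible_def by blast

lemma simple_square: "simple_refl s \<circ> simple_refl s = id"
  by (simp add: simple_refl_def)

lemma simple_braid:
  assumes "t = s + 1 \<or> s = t + 1"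
  shows "simple_refl s \<circ> (simple_refl t \<circ> simple_refl s) = transpose (min s t) (min s t + 2)"
    and "simple_refl s \<circ> (simple_refl t \<circ> simple_refl s) = simple_refl t \<circ> (simple_refl s \<circ> simple_refl t)"
proof -
  have up: "simple_refl i \<circ> (simple_refl (i + 1) \<circ> simple_refl i) = transpose i (i + 2)"
    and down: "simple_refl (i + 1) \<circ> (simple_refl i \<circ> simple_refl (i + 1)) = transpose i (i + 2)" for i
    by (simp_all add: fun_eq_iff simple_refl_def transpose_def)
  show "simple_refl s \<circ> (simple_refl t \<circ> simple_refl s) = transpose (min s t) (min s t + 2)"
    using assms up[of s] down[of t] by (elim disjE) simp_all
  show "simple_refl s \<circ> (simple_refl t \<circ> simple_refl s) = simple_refl t \<circ> (simple_refl s \<circ> simple_refl t)"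
    using assms up[of s] down[of s] up[of t] down[of t] by (elim disjE) simp_all
qed

text \<open>A square contributes nothing to the product, and a braid multiplies to the transposition of \<open>m\<close> and
  \<open>m + 2\<close>, which adds at most two to the displacement although it uses three letters.\<close>
lemma contractible_displacement:
  assumes "contractible ks" "set ks \<subseteq> {1..int n}"
  shows "displacement n (simple_prod ks) < length ks"
proof -
  from assms(1) consider us s vs where "ks = us @ [s, s] @ vs"
    | us s t vs where "t = s + 1 \<or> s = t + 1" "ks = us @ [s, t, s] @ vs"
    unfolding contractible_def by blast
  then show ?thesis
  proof cases
    case 1
    then have "set (us @ vs) \<subseteq> {1..int n}" using assms(2) by auto
    moreover have "simple_prod ks = simple_prod us \<circ> ((simple_refl s \<circ> simple_refl s) \<circ> simple_prod vs)"
      unfolding 1 by (simp add: comp_assoc)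
    then have "simple_prod ks = simple_prod (us @ vs)" by (simp add: simple_square)
    ultimately show ?thesis using displacement_le_length[of "us @ vs" n] 1 by simp
  next
    case 2
    let ?m = "min s t"
    have range: "set us \<subseteq> {1..int n}" "set vs \<subseteq> {1..int n}" "s \<in> {1..int n}" "t \<in> {1..int n}"
      using assms(2) 2(2) by auto
    let ?w = "transpose ?m (?m + 2) \<circ> simple_prod vs"
    have eq: "simple_prod ks = simple_prod us \<circ> ?w"
      unfolding 2(2) simple_braid(1)[OF 2(1), symmetric] by (simp add: comp_assoc)
    have perm: "simple_prod vs permutes {1..int n + 1}" using range by (intro simple_prod_permutes)
    moreover have "transpose ?m (?m + 2) permutes {1..int n + 1}"
      using range 2(1) by (intro permutes_swap_id) auto
    ultimately have "?w permutes {1..int n + 1}" by (rule permutes_compose)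
    from displacement_append_le[OF range(1) this]
    have "displacement n (simple_prod ks) \<le> length us + displacement n ?w" unfolding eq .
    also have "\<dots> \<le> length us + (displacement n (simple_prod vs) + 2)"
      using displacement_transpose[OF perm, of ?m "?m + 2"] by simp
    also have "\<dots> \<le> length us + (length vs + 2)" using displacement_le_length[OF range(2)] by simp
    finally show ?thesis unfolding 2(2) by simp
  qed
qed

section \<open>Commutation classes and runs\<close>

lemma commutation_invariant:
  assumes "(us, vs) \<in> (commutation_moves n)\<^sup>*"
  shows "word_prod us = word_prod vs \<and> mset us = mset vs"
  using assms
proof (induction rule: rtrancl_induct)
  case (step vs ws)
  from step(2) obtain a s t b where *: "vs = a @ [s, t] @ b" "ws = a @ [t, s] @ b" "s \<circ> t = t \<circ> s"
    unfolding commutation_moves_def by blast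
  have "word_prod vs = word_prod a \<circ> ((s \<circ> t) \<circ> word_prod b)" unfolding *(1) by (simp add: comp_assoc)
  also have "\<dots> = word_prod a \<circ> ((t \<circ> s) \<circ> word_prod b)" by (simp only: *(3))
  also have "\<dots> = word_prod ws" unfolding *(2) by (simp add: comp_assoc)
  finally show ?case using step(3) by (simp add: *(1,2))
qed simp

lemma commutation_sym:
  assumes "(us, vs) \<in> (commutation_moves n)\<^sup>*"
  shows "(vs, us) \<in> (commutation_moves n)\<^sup>*"
proof (rule symD[OF sym_rtrancl assms], rule symI)
  fix us vs assume "(us, vs) \<in> commutation_moves n"
  then obtain a s t b where "us = a @ [s, t] @ b" "vs = a @ [t, s] @ b"
    "s \<in> simple_refls n" "t \<in> simple_refls n" "s \<circ> t = t \<circ> s"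
    unfolding commutation_moves_def by blast
  moreover from this(5) have "t \<circ> s = s \<circ> t" by (rule sym)
  ultimately show "(vs, us) \<in> commutation_moves n"
    unfolding commutation_moves_def by blast
qed

lemma commutation_context:
  assumes "(us, vs) \<in> (commutation_moves n)\<^sup>*"
  shows "(a @ us @ b, a @ vs @ b) \<in> (commutation_moves n)\<^sup>*"
  using assms
proof (induction rule: rtrancl_induct)
  case (step vs ws)
  from step(2) obtain a' s t b' where *: "vs = a' @ [s, t] @ b'" "ws = a' @ [t, s] @ b'"
    "s \<in> simple_refls n" "t \<in> simple_refls n" "s \<circ> t = t \<circ> s"
    unfolding commutation_moves_def by blast
  have "a @ vs @ b = (a @ a') @ [s, t] @ (b' @ b)" "a @ ws @ b = (a @ a') @ [t, s] @ (b' @ b)"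
    by (simp_all add: *)
  with *(3-5) have "(a @ vs @ b, a @ ws @ b) \<in> commutation_moves n"
    unfolding commutation_moves_def by blast
  with step(3) show ?case by (rule rtrancl_into_rtrancl)
qed simp

text \<open>Commutation equivalence, transported to words in the indices of the generators.\<close>
definition comm_equiv :: "nat \<Rightarrow> int list \<Rightarrow> int list \<Rightarrow> bool" where
  "comm_equiv n us vs \<longleftrightarrow> (map simple_refl us, map simple_refl vs) \<in> (commutation_moves n)\<^sup>*"

lemma comm_equiv_refl [simp]: "comm_equiv n us us"
  by (simp add: comm_equiv_def)

lemma comm_equiv_trans [trans]: "comm_equiv n us vs \<Longrightarrow> comm_equiv n vs ws \<Longrightarrow> comm_equiv n us ws"
  unfolding comm_equiv_def by (rule rtrancl_trans)

lemma comm_equiv_context: "comm_equiv n us vs \<Longrightarrow> comm_equiv n (a @ us @ b) (a @ vs @ b)"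
  unfolding comm_equiv_def by (simp add: commutation_context)

lemma comm_equiv_sym: "comm_equiv n us vs \<Longrightarrow> comm_equiv n vs us"
  unfolding comm_equiv_def by (rule commutation_sym)

lemma comm_equiv_past:
  assumes "set us \<subseteq> {1..int n}" "k \<in> {1..int n}" "\<And>i. i \<in> set us \<Longrightarrow> i + 1 < k \<or> k + 1 < i"
  shows "comm_equiv n (us @ [k]) (k # us)"
  using assms
proof (induction us)
  case (Cons i us)
  have "simple_refl i \<circ> simple_refl k = simple_refl k \<circ> simple_refl i"
  proof -
    have "transpose i (i + 1) \<circ> transpose k (k + 1) = transpose k (k + 1) \<circ> transpose i (i + 1)"
      if "i + 1 < k \<or> k + 1 < i"
    proof
      fix x show "(transpose i (i + 1) \<circ> transpose k (k + 1)) x = (transpose k (k + 1) \<circ> transpose i (i + 1)) x"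
        using that by (cases "x = i \<or> x = i + 1") (auto simp: transpose_def)
    qed
    then show ?thesis using Cons.prems(3)[of i] by (simp add: simple_refl_def)
  qed
  moreover have "simple_refl i \<in> simple_refls n" "simple_refl k \<in> simple_refls n"
    using Cons.prems by (auto simp: simple_refls_def)
  ultimately have "([] @ [simple_refl i, simple_refl k] @ map simple_refl us,
      [] @ [simple_refl k, simple_refl i] @ map simple_refl us) \<in> commutation_moves n"
    unfolding commutation_moves_def by blast
  then have "comm_equiv n (i # k # us) (k # i # us)" by (simp add: comm_equiv_def)
  moreover have "comm_equiv n (us @ [k]) (k # us)" using Cons by simp
  from comm_equiv_context[OF this, of "[i]" "[]"]
  have "comm_equiv n (i # us @ [k]) (i # k # us)" by simp
  ultimately show ?case using comm_equiv_trans by simp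
qed simp

lemma inj_simple_refl: "simple_refl i = simple_refl j \<longleftrightarrow> i = j"
proof
  assume "simple_refl i = simple_refl j"
  then have "simple_refl j i = simple_refl i i" by simp
  also have "\<dots> = i + 1" by (simp add: simple_refl_def)
  finally have *: "transpose j (j + 1) i = i + 1" unfolding simple_refl_def .
  show "i = j"
  proof (rule ccontr)
    assume "i \<noteq> j"
    moreover have "i \<noteq> j + 1" using * by auto
    ultimately have "transpose j (j + 1) i = i" by (rule transpose_apply_other)
    with * show False by simp
  qed
qed simp

text \<open>Words of the form \<open>(i\<^sub>1 \<dots> j\<^sub>1)(i\<^sub>2 \<dots> j\<^sub>2) \<cdots>\<close>, given by the list of pairs \<open>(i\<^sub>m, j\<^sub>m)\<close>.\<close>
definition runs :: "(int \<times> int) list \<Rightarrow> int list" where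
  "runs ps = concat (map (\<lambda>(i, j). rev [j..i]) ps)"

definition run_pairs :: "nat \<Rightarrow> (int \<times> int) list \<Rightarrow> bool" where
  "run_pairs n ps \<longleftrightarrow> sorted_wrt (\<lambda>p q. fst p < fst q \<and> snd p < snd q) ps \<and>
     (\<forall>p \<in> set ps. 1 \<le> snd p \<and> snd p \<le> fst p \<and> fst p \<le> int n)"

lemma runs_simps [simp]: "runs [] = []" "runs (p # ps) = rev [snd p..fst p] @ runs ps"
  "runs (ps @ qs) = runs ps @ runs qs"
  by (auto simp: runs_def split: prod.split)

lemma set_runs: "run_pairs n ps \<Longrightarrow> set (runs ps) \<subseteq> {1..int n}"
  unfolding run_pairs_def by (induction ps) auto

lemma run_pairs_snoc:
  "run_pairs n (ps @ [(i, j)]) \<longleftrightarrow> run_pairs n ps \<and> (\<forall>p \<in> set ps. fst p < i \<and> snd p < j) \<and>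
     1 \<le> j \<and> j \<le> i \<and> i \<le> int n"
  by (auto simp: run_pairs_def sorted_wrt_append)

definition contracts :: "nat \<Rightarrow> int list \<Rightarrow> bool" where
  "contracts n us \<longleftrightarrow> (\<exists>vs. comm_equiv n us vs \<and> contractible vs)"

lemma contractsI: "comm_equiv n us vs \<Longrightarrow> contractible vs \<Longrightarrow> contracts n us"
  by (auto simp: contracts_def)

lemma contracts_context: "contracts n us \<Longrightarrow> contracts n (a @ us @ b)"
proof -
  assume "contracts n us"
  then obtain vs where vs: "comm_equiv n us vs" "contractible vs" by (auto simp: contracts_def)
  have "contractible (a @ vs @ b)"
  proof -
    from vs(2) consider us s ts where "vs = us @ [s, s] @ ts"
      | us s t ts where "t = s + 1 \<or> s = t + 1" "vs = us @ [s, t, s] @ ts"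
      unfolding contractible_def by blast
    then show ?thesis
    proof cases
      case 1
      then have "a @ vs @ b = (a @ us) @ [s, s] @ (ts @ b)" by simp
      then show ?thesis unfolding contractible_def by blast
    next
      case 2
      then have "a @ vs @ b = (a @ us) @ [s, t, s] @ (ts @ b)" by simp
      with 2(1) show ?thesis unfolding contractible_def by blast
    qed
  qed
  with comm_equiv_context[OF vs(1)] show ?thesis by (rule contractsI)
qed

lemma contracts_equiv: "comm_equiv n us vs \<Longrightarrow> contracts n vs \<Longrightarrow> contracts n us"
  unfolding contracts_def using comm_equiv_trans by blast

text \<open>Let \<open>(i, j)\<close> be the last run. A letter \<open>k > i\<close> forms a run of its own; \<open>k = j\<close> gives a square; if
  \<open>j < k \<le> i\<close>, then \<open>k\<close> moves left until it meets \<open>k, k - 1\<close> and gives a braid; \<open>k = j - 1\<close> extends the run,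
  unless the previous run ends in \<open>k\<close> as well, in which case that earlier \<open>k\<close> moves right to complete a braid
  \<open>k, j, k\<close>; and \<open>k < j - 1\<close> commutes past the whole run. The inclusions in the conclusion ensure that in the
  last case the run \<open>(i, j)\<close> can be put back at the end.\<close>
lemma append_letter:
  assumes "run_pairs n ps" "k \<in> {1..int n}"
  shows "contracts n (runs ps @ [k]) \<or>
    (\<exists>qs. run_pairs n qs \<and> comm_equiv n (runs ps @ [k]) (runs qs) \<and>
      fst ` set qs \<subseteq> insert k (fst ` set ps) \<and> snd ` set qs \<subseteq> insert k (snd ` set ps))"
  using assms(1)
proof (induction ps rule: rev_induct)
  case Nil
  have "run_pairs n [(k, k)]" using assms(2) by (simp add: run_pairs_def)
  then show ?case by (intro disjI2 exI[of _ "[(k, k)]"]) auto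
next
  case (snoc p ps)
  obtain i j where p: "p = (i, j)" by (cases p)
  from snoc.prems have ps: "run_pairs n ps" and below: "\<forall>p \<in> set ps. fst p < i \<and> snd p < j"
    and ij: "1 \<le> j" "j \<le> i" "i \<le> int n" unfolding p run_pairs_snoc by auto
  have k: "1 \<le> k" "k \<le> int n" using assms(2) by auto
  have word: "runs (ps @ [p]) @ [k] = runs ps @ rev [j..i] @ [k]" by (simp add: p)
  consider "i < k" | "k = j" | "j < k" "k \<le> i" | "k = j - 1" | "k < j - 1" by linarith
  then show ?case
  proof cases
    case 1
    have "run_pairs n ((ps @ [p]) @ [(k, k)])"
      using snoc.prems below ij k 1 unfolding run_pairs_snoc p by auto
    then show ?thesis by (intro disjI2 exI[of _ "(ps @ [p]) @ [(k, k)]"]) auto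
  next
    case 2
    then have "runs (ps @ [p]) @ [k] = (runs ps @ rev [j + 1..i]) @ [j, j] @ []"
      using ij upto_rec1[of j i] by (simp add: p)
    then have "contractible (runs (ps @ [p]) @ [k])" using contractible_square by metis
    then show ?thesis by (intro disjI1 contractsI[OF comm_equiv_refl])
  next
    case 3
    have "[j..i] = [j..k - 2] @ [k - 1, k] @ [k + 1..i]"
      using 3 upto_split3[of j k i] upto_rec2[of j "k - 1"] by simp
    then have eq: "runs (ps @ [p]) @ [k] =
        (runs ps @ rev [k + 1..i] @ [k, k - 1]) @ (rev [j..k - 2] @ [k]) @ []"
      unfolding word by simp
    have "comm_equiv n (rev [j..k - 2] @ [k]) (k # rev [j..k - 2])"
      using ij k by (intro comm_equiv_past) auto
    from comm_equiv_context[OF this, of "runs ps @ rev [k + 1..i] @ [k, k - 1]" "[]"]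
    have "comm_equiv n (runs (ps @ [p]) @ [k])
        ((runs ps @ rev [k + 1..i]) @ [k, k - 1, k] @ rev [j..k - 2])"
      unfolding eq by simp
    moreover have "contractible ((runs ps @ rev [k + 1..i]) @ [k, k - 1, k] @ rev [j..k - 2])"
      by (rule contractible_braid) simp
    ultimately show ?thesis by (intro disjI1 contractsI)
  next
    case 4
    show ?thesis
    proof (cases "\<forall>q \<in> set ps. snd q < k")
      case True
      have "runs (ps @ [p]) @ [k] = runs (ps @ [(i, k)])"
        using 4 ij upto_rec1[of k i] by (simp add: p)
      moreover have "run_pairs n (ps @ [(i, k)])"
        using ps below ij k 4 True unfolding run_pairs_snoc by auto
      ultimately show ?thesis by (intro disjI2 exI[of _ "ps @ [(i, k)]"]) (auto simp: p)
    next
      case False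
      then have "ps \<noteq> []" by auto
      then obtain qs i' j' where qs: "ps = qs @ [(i', j')]" by (metis rev_exhaust prod.collapse)
      from ps have qs': "\<forall>q \<in> set qs. snd q < j'" and ij': "j' \<le> i'"
        unfolding qs run_pairs_snoc by auto
      from below have "i' < i" "j' < j" unfolding qs by auto
      with False qs' 4 have j': "j' = k" unfolding qs by force
      have last: "rev [j'..i'] = rev [k + 1..i'] @ [k]" "rev [j..i] = rev [j + 1..i] @ [j]"
        using ij ij' upto_rec1[of k i'] upto_rec1[of j i] unfolding j' by simp_all
      have "runs (ps @ [p]) @ [k] = runs qs @ rev [j'..i'] @ rev [j..i] @ [k]"
        by (simp add: qs p)
      then have eq: "runs (ps @ [p]) @ [k] =
          (runs qs @ rev [k + 1..i']) @ (k # rev [j + 1..i]) @ [j, k]"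
        unfolding last append_assoc append_Cons append_Nil .
      have "comm_equiv n (rev [j + 1..i] @ [k]) (k # rev [j + 1..i])"
        using ij k 4 by (intro comm_equiv_past) auto
      from comm_equiv_context[OF comm_equiv_sym[OF this], of "runs qs @ rev [k + 1..i']" "[j, k]"]
      have "comm_equiv n (runs (ps @ [p]) @ [k])
          ((runs qs @ rev [k + 1..i'] @ rev [j + 1..i]) @ [k, j, k] @ [])"
        unfolding eq by simp
      moreover have "contractible ((runs qs @ rev [k + 1..i'] @ rev [j + 1..i]) @ [k, j, k] @ [])"
        using 4 by (intro contractible_braid) simp
      ultimately show ?thesis by (intro disjI1 contractsI)
    qed
  next
    case 5
    have "comm_equiv n (rev [j..i] @ [k]) (k # rev [j..i])"
      using ij k 5 by (intro comm_equiv_past) auto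
    from comm_equiv_context[OF this, of "runs ps" "[]"]
    have eq: "comm_equiv n (runs (ps @ [p]) @ [k]) ([] @ (runs ps @ [k]) @ rev [j..i])"
      unfolding word by simp
    from snoc.IH[OF ps] show ?thesis
    proof (elim disjE exE conjE)
      assume "contracts n (runs ps @ [k])"
      from contracts_context[OF this] have "contracts n ([] @ (runs ps @ [k]) @ rev [j..i])" .
      then show ?thesis using contracts_equiv[OF eq] by (intro disjI1)
    next
      fix qs assume qs: "run_pairs n qs" "comm_equiv n (runs ps @ [k]) (runs qs)"
        "fst ` set qs \<subseteq> insert k (fst ` set ps)" "snd ` set qs \<subseteq> insert k (snd ` set ps)"
      have "\<forall>q \<in> set qs. fst q < i \<and> snd q < j"
      proof
        fix q assume "q \<in> set qs"
        then have "fst q \<in> insert k (fst ` set ps)" "snd q \<in> insert k (snd ` set ps)"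
          using qs(3,4) by blast+
        then show "fst q < i \<and> snd q < j" using below 5 ij by auto
      qed
      then have "run_pairs n (qs @ [p])" using qs(1) ij unfolding run_pairs_snoc p by auto
      moreover have "comm_equiv n (runs (ps @ [p]) @ [k]) (runs (qs @ [p]))"
        using comm_equiv_trans[OF eq comm_equiv_context[OF qs(2)]] by (simp add: p)
      ultimately show ?thesis using qs(3,4) by (intro disjI2 exI[of _ "qs @ [p]"]) auto
    qed
  qed
qed

lemma word_contracts_or_normal_form:
  assumes "set ks \<subseteq> {1..int n}"
  shows "contracts n ks \<or> (\<exists>ps. run_pairs n ps \<and> comm_equiv n ks (runs ps))"
  using assms
proof (induction ks rule: rev_induct)
  case Nil
  have "run_pairs n []" by (simp add: run_pairs_def)
  then show ?case by (intro disjI2 exI[of _ "[]"]) simp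
next
  case (snoc k ks)
  then consider "contracts n ks" | ps where "run_pairs n ps" "comm_equiv n ks (runs ps)" by auto
  then show ?case
  proof cases
    case 1
    from contracts_context[OF this, of "[]" "[k]"] show ?thesis by simp
  next
    case 2
    have eq: "comm_equiv n (ks @ [k]) (runs ps @ [k])"
      using comm_equiv_context[OF 2(2), of "[]" "[k]"] by simp
    have "k \<in> {1..int n}" using snoc.prems by simp
    from append_letter[OF 2(1) this] show ?thesis
    proof (elim disjE exE conjE)
      assume "contracts n (runs ps @ [k])"
      then show ?thesis using contracts_equiv[OF eq] by (intro disjI1)
    next
      fix qs assume "run_pairs n qs" "comm_equiv n (runs ps @ [k]) (runs qs)"
      then show ?thesis using comm_equiv_trans[OF eq] by blast
    qed
  qed
qed

section \<open>Fully commutative elements from their excedances\<close>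

lemma simple_prod_run:
  assumes "j \<le> i"
  shows "simple_prod (rev [j..i]) k = (if k = j then i + 1 else if j < k \<and> k \<le> i + 1 then k - 1 else k)"
  using assms
proof (induction i arbitrary: k rule: int_ge_induct)
  case base
  then show ?case by (auto simp: simple_refl_def transpose_def)
next
  case (step i)
  then have "rev [j..i + 1] = (i + 1) # rev [j..i]" by (simp add: upto_rec2[of j "i + 1"])
  then have "simple_prod (rev [j..i + 1]) k = transpose (i + 1) (i + 1 + 1) (simple_prod (rev [j..i]) k)"
    unfolding simple_refl_def[of "i + 1", symmetric] by simp
  then show ?case using step.hyps unfolding step.IH by (auto simp: transpose_def)
qed

text \<open>The last run acts first. Its bottom index \<open>j\<close> is sent to \<open>i + 1\<close>, which is out of reach of the other runs.
  A letter that has been moved down by a run stays above the bottom indices of all earlier runs, and so is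
  never raised. The third part serves the induction: small letters are fixed.\<close>
lemma simple_prod_runs_apply:
  assumes "run_pairs n ps"
  shows "(i, j) \<in> set ps \<Longrightarrow> simple_prod (runs ps) j = i + 1"
    and "k \<notin> snd ` set ps \<Longrightarrow> simple_prod (runs ps) k \<le> k"
    and "(\<And>p. p \<in> set ps \<Longrightarrow> k < snd p) \<Longrightarrow> simple_prod (runs ps) k = k"
  using assms
proof (induction ps arbitrary: i j k)
  case Nil
  { case 1 then show ?case by simp next case 2 then show ?case by simp next case 3 then show ?case by simp }
next
  case (Cons p ps)
  obtain a b where p: "p = (a, b)" by (cases p)
  let ?w = "simple_prod (runs ps)" and ?r = "simple_prod (rev [b..a])"
  have eq: "simple_prod (runs (p # ps)) k = ?r (?w k)" for k by (simp add: p)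
  have *: "run_pairs n ps" "b \<le> a" "\<And>q. q \<in> set ps \<Longrightarrow> a < fst q \<and> b < snd q"
    if "run_pairs n (p # ps)" using that by (auto simp: run_pairs_def p)
  have wb: "?w b = b" if "run_pairs n (p # ps)"
    using Cons.IH(3)[of b] *[OF that] by blast
  {
    case (1 i j)
    note * = *[OF 1(2)]
    show ?case
    proof (cases "(i, j) = (a, b)")
      case True
      then show ?thesis using wb[OF 1(2)] *(2) unfolding eq by (simp add: simple_prod_run)
    next
      case False
      then have ij: "(i, j) \<in> set ps" using 1 by (auto simp: p)
      then have "?w j = i + 1" using Cons.IH(1) *(1) by blast
      moreover have "a < i" using *(3)[OF ij] by simp
      ultimately show ?thesis using *(2) unfolding eq by (simp add: simple_prod_run)
    qed
  next
    case (2 k)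
    note * = *[OF 2(2)]
    have k: "k \<notin> snd ` set ps" "k \<noteq> b" using 2(1) by (auto simp: p)
    have "?w permutes {1..int n + 1}" using set_runs[OF *(1)] by (rule simple_prod_permutes)
    then have "?w k \<noteq> b" using wb[OF 2(2)] k(2) permutes_inj by (metis injD)
    moreover have "?w k \<le> k" using Cons.IH(2)[OF k(1)] *(1) by blast
    ultimately show ?case using *(2) unfolding eq by (simp add: simple_prod_run)
  next
    case (3 k)
    note * = *[OF 3(2)]
    have "k < b" using 3(1)[of p] by (simp add: p)
    moreover have "?w k = k" using Cons.IH(3)[of k] 3(1) *(1) by simp
    ultimately show ?case using *(2) unfolding eq by (simp add: simple_prod_run)
  }
qed

lemma excedances_runs:
  assumes "run_pairs n ps"
  shows "excedances (simple_prod (runs ps)) = snd ` set ps"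
    and "simple_prod (runs ps) ` excedances (simple_prod (runs ps)) = (\<lambda>p. fst p + 1) ` set ps"
proof -
  let ?w = "simple_prod (runs ps)"
  have w: "?w (snd p) = fst p + 1" if "p \<in> set ps" for p
    using simple_prod_runs_apply(1)[OF assms, of "fst p" "snd p"] that by simp
  have "snd p < ?w (snd p)" if "p \<in> set ps" for p
    using w[OF that] assms that unfolding run_pairs_def by fastforce
  then show exc: "excedances ?w = snd ` set ps"
    using simple_prod_runs_apply(2)[OF assms] unfolding excedances_def by (auto simp: not_le[symmetric])
  show "?w ` excedances ?w = (\<lambda>p. fst p + 1) ` set ps"
    unfolding exc image_image using w by auto
qed

lemma run_pairs_sorted:
  assumes "run_pairs n ps"
  shows "sorted_wrt (<) (map fst ps)" "sorted_wrt (<) (map snd ps)"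
proof -
  have "sorted_wrt (\<lambda>p q. fst p < fst q) ps" "sorted_wrt (\<lambda>p q. snd p < snd q) ps"
    using assms unfolding run_pairs_def by (auto elim: sorted_wrt_mono_rel[rotated])
  then show "sorted_wrt (<) (map fst ps)" "sorted_wrt (<) (map snd ps)"
    by (simp_all add: sorted_wrt_map)
qed

text \<open>The data of the runs are recovered as the excedances of the product and their values.\<close>
lemma runs_unique:
  assumes "run_pairs n ps" "run_pairs n qs" "simple_prod (runs ps) = simple_prod (runs qs)"
  shows "ps = qs"
proof -
  have "set (map snd ps) = set (map snd qs)"
    using excedances_runs(1)[OF assms(1)] excedances_runs(1)[OF assms(2)] assms(3) by simp
  then have snd: "map snd ps = map snd qs"
    using run_pairs_sorted(2) assms(1,2) by (intro strict_sorted_equal) auto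
  have "(\<lambda>i. i + 1) ` set (map fst ps) = (\<lambda>i. i + 1) ` set (map fst qs)"
    using excedances_runs(2)[OF assms(1)] excedances_runs(2)[OF assms(2)] assms(3)
    by (simp add: image_image)
  then have "set (map fst ps) = set (map fst qs)" by (simp add: inj_image_eq_iff inj_on_def)
  then have "map fst ps = map fst qs"
    using run_pairs_sorted(1) assms(1,2) by (intro strict_sorted_equal) auto
  with snd show ?thesis by (metis zip_map_fst_snd)
qed

text \<open>The run \<open>(i, j)\<close> has \<open>i + 1 - j\<close> letters and raises \<open>j\<close> by exactly this amount.\<close>
lemma displacement_runs:
  assumes "run_pairs n ps"
  shows "displacement n (simple_prod (runs ps)) = length (runs ps)"
proof -
  let ?w = "simple_prod (runs ps)"
  have perm: "?w permutes {1..int n + 1}" using set_runs[OF assms] by (rule simple_prod_permutes)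
  have dist: "distinct (map snd ps)"
    using run_pairs_sorted(2)[OF assms] strict_sorted_iff by blast
  have w: "?w (snd p) = fst p + 1" if "p \<in> set ps" for p
    using simple_prod_runs_apply(1)[OF assms, of "fst p" "snd p"] that by simp
  have "displacement n ?w = (\<Sum>k \<in> excedances ?w. nat (?w k - k))"
    unfolding displacement_def using excedances_subset(1)[OF perm]
    by (intro sum.mono_neutral_right) (auto simp: excedances_def)
  also have "\<dots> = (\<Sum>k \<in> set (map snd ps). nat (?w k - k))"
    using excedances_runs(1)[OF assms] by simp
  also have "\<dots> = sum_list (map (\<lambda>k. nat (?w k - k)) (map snd ps))"
    using dist by (intro sum.distinct_set_conv_list)
  also have "\<dots> = sum_list (map (\<lambda>p. nat (fst p + 1 - snd p)) ps)"
    using w by (intro arg_cong[of _ _ sum_list]) auto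
  also have "\<dots> = length (runs ps)"
    by (simp add: runs_def length_concat comp_def split_def algebra_simps)
  finally show ?thesis .
qed

lemma simple_refl_word:
  assumes "set ws \<subseteq> simple_refls n"
  obtains ks where "ws = map simple_refl ks" "set ks \<subseteq> {1..int n}"
proof -
  have "\<exists>ks. ws = map simple_refl ks \<and> set ks \<subseteq> {1..int n}"
    using assms
  proof (induction ws)
    case (Cons w ws)
    then obtain ks k where "ws = map simple_refl ks" "set ks \<subseteq> {1..int n}"
      "w = simple_refl k" "k \<in> {1..int n}" by (auto simp: simple_refls_def)
    then show ?case by (intro exI[of _ "k # ks"]) auto
  qed simp
  with that show thesis by blast
qed

lemma reduced_decomp_length_eq:
  assumes "reduced_decomp n ws w" "set vs \<subseteq> simple_refls n" "word_prod vs = w"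
  shows "length ws \<le> length vs" "length vs = length ws \<Longrightarrow> reduced_decomp n vs w"
  using assms word_length_le[of vs "simple_refls n"] by (auto simp: reduced_decomp_def)

lemma simple_refls_map: "set ks \<subseteq> {1..int n} \<Longrightarrow> set (map simple_refl ks) \<subseteq> simple_refls n"
  by (auto simp: simple_refls_def)

lemma reduced_decomp_runs:
  assumes "run_pairs n ps"
  shows "reduced_decomp n (map simple_refl (runs ps)) (simple_prod (runs ps))"
proof -
  have set: "set (map simple_refl (runs ps)) \<subseteq> simple_refls n"
    using set_runs[OF assms] by (rule simple_refls_map)
  from word_length_attained[OF this] obtain vs where vs: "set vs \<subseteq> simple_refls n"
    "word_prod vs = simple_prod (runs ps)"
    "length vs = word_length (simple_refls n) (simple_prod (runs ps))" .
  from simple_refl_word[OF vs(1)] obtain ks where ks: "vs = map simple_refl ks" "set ks \<subseteq> {1..int n}" .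
  have "length (runs ps) \<le> length vs"
    using displacement_le_length[OF ks(2)] displacement_runs[OF assms] vs(2) ks(1) by simp
  with set word_length_le[OF set] vs(3) show ?thesis by (simp add: reduced_decomp_def)
qed

lemma comm_equiv_simple_refls:
  assumes "comm_equiv n us vs" "set us \<subseteq> {1..int n}"
  shows "simple_prod us = simple_prod vs" "length us = length vs" "set vs \<subseteq> {1..int n}"
proof -
  have *: "simple_prod us = simple_prod vs" "mset (map simple_refl us) = mset (map simple_refl vs)"
    using commutation_invariant assms(1) unfolding comm_equiv_def by blast+
  then show "simple_prod us = simple_prod vs" by blast
  show "length us = length vs" using *(2) by (metis length_map mset_eq_length)
  have "simple_refl ` set us = simple_refl ` set vs" using *(2) by (metis list.set_map mset_eq_setD)
  moreover have "inj simple_refl" by (simp add: inj_on_def inj_simple_refl)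
  ultimately have "set us = set vs" by (simp add: inj_image_eq_iff)
  with assms(2) show "set vs \<subseteq> {1..int n}" by simp
qed

text \<open>A reduced word of a fully commutative element cannot contract: a square could be deleted, and a braid
  move would give a reduced word with another multiset of letters, whereas commutations preserve this multiset.
  Conversely, any reduced word of a product of runs is as long as the displacement of the product, so it
  cannot contract either, and it is commutation equivalent to a run word, which is unique.\<close>
theorem fully_comm_iff_runs:
  "w \<in> fully_comm n \<longleftrightarrow> (\<exists>ps. run_pairs n ps \<and> w = simple_prod (runs ps))"
proof
  assume w: "w \<in> fully_comm n"
  then have "w permutes {1..int n + 1}" by (simp add: fully_comm_def sym_gp_def)
  then obtain ls where ls: "set ls \<subseteq> {1..int n}" "w = simple_prod ls" by (rule simple_words_exist)
  obtain ws where
    "set ws \<subseteq> simple_refls n" "word_prod ws = w" "length ws = word_length (simple_refls n) w"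
    unfolding ls(2) by (rule word_length_attained[OF simple_refls_map[OF ls(1)]])
  then have ws: "set ws \<subseteq> simple_refls n" "reduced_decomp n ws w"
    by (simp_all add: reduced_decomp_def)
  obtain ks where "ws = map simple_refl ks" and ks_set: "set ks \<subseteq> {1..int n}"
    by (rule simple_refl_word[OF ws(1)])
  with ws(2) have "reduced_decomp n (map simple_refl ks) w" by simp
  note ks = ks_set this
  then have w_eq: "w = simple_prod ks" by (simp add: reduced_decomp_def)
  from word_contracts_or_normal_form[OF ks(1)]
  show "\<exists>ps. run_pairs n ps \<and> w = simple_prod (runs ps)"
  proof (elim disjE exE conjE)
    assume "contracts n ks"
    then obtain vs where vs: "comm_equiv n ks vs" "contractible vs" by (auto simp: contracts_def)
    note inv = comm_equiv_simple_refls[OF vs(1) ks(1)]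
    have vs_red: "reduced_decomp n (map simple_refl vs) w"
    proof (rule reduced_decomp_length_eq(2)[OF ks(2) simple_refls_map[OF inv(3)]])
      show "simple_prod vs = w" unfolding w_eq by (rule inv(1)[symmetric])
      show "length (map simple_refl vs) = length (map simple_refl ks)" using inv(2) by simp
    qed
    from vs(2) consider us s ts where "vs = us @ [s, s] @ ts"
      | us s t ts where "t = s + 1 \<or> s = t + 1" "vs = us @ [s, t, s] @ ts"
      unfolding contractible_def by blast
    then have False
    proof cases
      case 1
      have "simple_prod vs = simple_prod us \<circ> ((simple_refl s \<circ> simple_refl s) \<circ> simple_prod ts)"
        unfolding 1 by (simp add: comp_assoc)
      then have "simple_prod (us @ ts) = w" using inv(1) w_eq by (simp add: simple_square)
      moreover have "set (us @ ts) \<subseteq> {1..int n}" using inv(3) 1 by auto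
      ultimately have "length (map simple_refl vs) \<le> length (map simple_refl (us @ ts))"
        by (intro reduced_decomp_length_eq(1)[OF vs_red simple_refls_map])
      then show False by (simp add: 1)
    next
      case 2
      let ?vs' = "us @ [t, s, t] @ ts"
      have "simple_prod vs = simple_prod us \<circ>
          ((simple_refl s \<circ> (simple_refl t \<circ> simple_refl s)) \<circ> simple_prod ts)"
        unfolding 2(2) by (simp add: comp_assoc)
      also have "\<dots> = simple_prod ?vs'"
        unfolding simple_braid(2)[OF 2(1)] by (simp add: comp_assoc)
      finally have "simple_prod ?vs' = w" using inv(1) w_eq by simp
      moreover have "set ?vs' \<subseteq> {1..int n}" using inv(3) 2(2) by auto
      moreover have "length (map simple_refl ?vs') = length (map simple_refl vs)" by (simp add: 2(2))
      ultimately have "reduced_decomp n (map simple_refl ?vs') w"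
        by (intro reduced_decomp_length_eq(2)[OF vs_red simple_refls_map])
      with vs_red w have "(map simple_refl vs, map simple_refl ?vs') \<in> (commutation_moves n)\<^sup>*"
        unfolding fully_comm_def by blast
      then have "mset (map simple_refl vs) = mset (map simple_refl ?vs')"
        using commutation_invariant by blast
      then have "simple_refl s = simple_refl t" by (simp add: 2(2))
      then show False using 2(1) by (auto simp: inj_simple_refl)
    qed
    then show ?thesis ..
  next
    fix ps assume ps: "run_pairs n ps" "comm_equiv n ks (runs ps)"
    have "w = simple_prod (runs ps)"
      unfolding w_eq by (rule comm_equiv_simple_refls(1)[OF ps(2) ks(1)])
    with ps(1) show ?thesis by blast
  qed
next
  assume "\<exists>ps. run_pairs n ps \<and> w = simple_prod (runs ps)"
  then obtain ps where ps: "run_pairs n ps" "w = simple_prod (runs ps)" by blast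
  have to_runs: "(ws, map simple_refl (runs ps)) \<in> (commutation_moves n)\<^sup>*"
    if ws: "reduced_decomp n ws w" for ws
  proof -
    from ws simple_refl_word[of ws n] obtain ks where ks: "ws = map simple_refl ks"
      "set ks \<subseteq> {1..int n}" by (auto simp: reduced_decomp_def)
    have w_eq: "simple_prod ks = w" and len: "length ks = length (runs ps)"
      using ws reduced_decomp_runs[OF ps(1)] ps(2) ks(1) by (simp_all add: reduced_decomp_def)
    have "\<not> contracts n ks"
    proof
      assume "contracts n ks"
      then obtain vs where vs: "comm_equiv n ks vs" "contractible vs" by (auto simp: contracts_def)
      note inv = comm_equiv_simple_refls[OF vs(1) ks(2)]
      show False using contractible_displacement[OF vs(2) inv(3)] inv(1,2) w_eq len
          displacement_runs[OF ps(1)] ps(2) by simp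
    qed
    then obtain qs where qs: "run_pairs n qs" "comm_equiv n ks (runs qs)"
      using word_contracts_or_normal_form[OF ks(2)] by blast
    then have "qs = ps"
      using comm_equiv_simple_refls(1)[OF qs(2) ks(2)] w_eq ps by (intro runs_unique) auto
    with qs(2) show ?thesis by (simp add: comm_equiv_def ks(1))
  qed
  have "w permutes {1..int n + 1}"
    unfolding ps(2) using set_runs[OF ps(1)] by (rule simple_prod_permutes)
  then show "w \<in> fully_comm n"
    unfolding fully_comm_def sym_gp_def
    by (simp, intro allI impI rtrancl_trans[OF to_runs commutation_sym[OF to_runs]])
qed

lemma normal_form_iff_runs:
  "normal_form n w is js \<longleftrightarrow>
    (\<exists>ps. run_pairs n ps \<and> w = simple_prod (runs ps) \<and> is = map fst ps \<and> js = map snd ps)"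
proof
  have word: "concat (map2 descending_run (map fst ps) (map snd ps)) = map simple_refl (runs ps)" for ps
    by (induction ps) (auto simp: descending_run_def)
  show "\<exists>ps. run_pairs n ps \<and> w = simple_prod (runs ps) \<and> is = map fst ps \<and> js = map snd ps"
    if nf: "normal_form n w is js"
  proof -
    define ps where "ps = zip is js"
    have all: "list_all2 (\<le>) js is" using nf by (simp add: normal_form_def)
    then have len: "length js = length is" by (rule list_all2_lengthD)
    have ij: "is = map fst ps" "js = map snd ps" using len by (simp_all add: ps_def)
    have sorted: "sorted_wrt (\<lambda>p q. fst p < fst q) ps" "sorted_wrt (\<lambda>p q. snd p < snd q) ps"
      using nf unfolding normal_form_def ij sorted_wrt_map by simp_all
    then have "sorted_wrt (\<lambda>p q. fst p < fst q \<and> snd p < snd q) ps"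
      by (simp add: sorted_wrt_iff_nth_less)
    moreover have "snd p \<le> fst p" if "p \<in> set ps" for p
      using all that unfolding ij by (auto simp: list_all2_map1 list_all2_map2 list_all2_same)
    moreover have "1 \<le> snd p" "fst p \<le> int n" if "p \<in> set ps" for p
      using nf that unfolding normal_form_def ij by auto
    ultimately have "run_pairs n ps" by (simp add: run_pairs_def)
    moreover have "w = simple_prod (runs ps)"
      using nf unfolding normal_form_def ij word by (simp add: reduced_decomp_def)
    ultimately show ?thesis using ij by blast
  qed
  show "normal_form n w is js"
    if "\<exists>ps. run_pairs n ps \<and> w = simple_prod (runs ps) \<and> is = map fst ps \<and> js = map snd ps"
  proof -
    from that obtain ps where ps: "run_pairs n ps" "w = simple_prod (runs ps)"
      "is = map fst ps" "js = map snd ps" by blast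
    have "list_all2 (\<le>) (map snd ps) (map fst ps)" "set (map fst ps) \<subseteq> {1..int n}"
      "set (map snd ps) \<subseteq> {1..int n}"
      using ps(1) by (force simp: run_pairs_def list_all2_map1 list_all2_map2 list_all2_same)+
    then show ?thesis
      unfolding normal_form_def ps(2-4) word
      using run_pairs_sorted[OF ps(1)] reduced_decomp_runs[OF ps(1)] by blast
  qed
qed

lemma I_J_set_runs:
  assumes "run_pairs n ps"
  shows "I_set n (simple_prod (runs ps)) = fst ` set ps" "J_set n (simple_prod (runs ps)) = snd ` set ps"
proof -
  have "(THE (is, js). normal_form n (simple_prod (runs ps)) is js) = (map fst ps, map snd ps)"
  proof (rule the_equality)
    show "case (map fst ps, map snd ps) of (is, js) \<Rightarrow> normal_form n (simple_prod (runs ps)) is js"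
      using assms by (auto simp: normal_form_iff_runs)
    fix x assume "case x of (is, js) \<Rightarrow> normal_form n (simple_prod (runs ps)) is js"
    then show "x = (map fst ps, map snd ps)"
      using runs_unique[OF _ assms] by (auto simp: normal_form_iff_runs split: prod.splits)
  qed
  then show "I_set n (simple_prod (runs ps)) = fst ` set ps"
    "J_set n (simple_prod (runs ps)) = snd ` set ps"
    by (simp_all add: I_set_def J_set_def)
qed

section \<open>The two bijections with admissible pairs\<close>

text \<open>If \<open>u\<^sub>k \<le> d\<^sub>k\<close>, then at least \<open>k + 1\<close> elements on the upper side are at most \<open>u\<^sub>k\<close> but at most \<open>k\<close>
  elements on the lower side are below \<open>u\<^sub>k\<close> (indices start at \<open>0\<close>).\<close>
lemma dominates_nth:
  assumes "dominates (set us) (set ds)" "sorted_wrt (<) us" "sorted_wrt (<) ds"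
  shows "length ds = length us" "k < length us \<Longrightarrow> ds ! k < us ! k"
proof -
  have dist: "distinct us" "distinct ds" using assms(2,3) strict_sorted_iff by blast+
  then show len: "length ds = length us"
    using assms(1) by (simp add: dominates_def distinct_card)
  show "ds ! k < us ! k" if k: "k < length us"
  proof (rule ccontr)
    assume neg: "\<not> ds ! k < us ! k"
    have less: "xs ! a \<le> xs ! b \<longleftrightarrow> a \<le> b"
      if "sorted_wrt (<) xs" "a < length xs" "b < length xs" for xs :: "int list" and a b
      using that sorted_wrt_nth_less[OF that(1), of a b] sorted_wrt_nth_less[OF that(1), of b a]
      by (cases a b rule: linorder_cases) auto
    have "(!) us ` {..k} \<subseteq> {u \<in> set us. u \<le> us ! k}"
      using less[OF assms(2)] k by auto
    moreover have "inj_on ((!) us) {..k}" using dist(1) k by (auto simp: inj_on_def nth_eq_iff_index_eq)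
    ultimately have "Suc k \<le> card {u \<in> set us. u \<le> us ! k}"
      using card_mono[of "{u \<in> set us. u \<le> us ! k}" "(!) us ` {..k}"] by (simp add: card_image)
    also have "\<dots> \<le> card {d \<in> set ds. d < us ! k}" using assms(1) by (simp add: dominates_def)
    also have "{d \<in> set ds. d < us ! k} \<subseteq> (!) ds ` {..<k}"
    proof
      fix d assume d: "d \<in> {d \<in> set ds. d < us ! k}"
      then obtain a where a: "d = ds ! a" "a < length ds" by (auto simp: in_set_conv_nth)
      then have "\<not> ds ! k \<le> ds ! a" using d neg by auto
      then have "a < k" using less[OF assms(3), of k a] a(2) k len by auto
      with a(1) show "d \<in> (!) ds ` {..<k}" by blast
    qed
    then have "card {d \<in> set ds. d < us ! k} \<le> card ((!) ds ` {..<k})" by (intro card_mono) auto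
    also have "\<dots> \<le> k" using card_image_le[of "{..<k}" "(!) ds"] by simp
    finally show False by simp
  qed
qed

definition admissible :: "nat \<Rightarrow> (int set \<times> int set) set" where
  "admissible n = {(D, I). D \<subseteq> {1..int n} \<and> I \<subseteq> {1..int n} \<and> dominates (shift I 1) D}"

lemma shift_eq_image: "shift A m = (\<lambda>a. a + m) ` A"
  by (auto simp: shift_def)

lemma run_pairs_exist:
  assumes "(D, I) \<in> admissible n"
  obtains ps where "run_pairs n ps" "snd ` set ps = D" "fst ` set ps = I"
proof -
  have D: "D \<subseteq> {1..int n}" and I: "I \<subseteq> {1..int n}" and dom: "dominates (shift I 1) D"
    using assms by (auto simp: admissible_def)
  have fin: "finite D" "finite I" using D I finite_subset by blast+
  define rs js where "rs = sorted_list_of_set I" and "js = sorted_list_of_set D"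
  have sets: "set rs = I" "set js = D" using fin by (simp_all add: rs_def js_def)
  have sorted: "sorted_wrt (<) rs" "sorted_wrt (<) js" by (simp_all add: rs_def js_def)
  have "sorted_wrt (<) (map (\<lambda>i. i + 1) rs)" using sorted(1) by (simp add: sorted_wrt_iff_nth_less add1_zle_eq)
  moreover have "dominates (set (map (\<lambda>i. i + 1) rs)) (set js)"
    using dom by (simp add: sets shift_eq_image)
  ultimately have len: "length js = length rs" and le: "\<And>k. k < length rs \<Longrightarrow> js ! k \<le> rs ! k"
    using dominates_nth[of "map (\<lambda>i. i + 1) rs" js] sorted(2) by force+
  have "run_pairs n (zip rs js)"
    unfolding run_pairs_def
  proof
    show "sorted_wrt (\<lambda>p q. fst p < fst q \<and> snd p < snd q) (zip rs js)"
      using sorted len by (simp add: sorted_wrt_iff_nth_less)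
    show "\<forall>p\<in>set (zip rs js). 1 \<le> snd p \<and> snd p \<le> fst p \<and> fst p \<le> int n"
    proof
      fix p assume "p \<in> set (zip rs js)"
      then obtain k where k: "p = (rs ! k, js ! k)" "k < length rs" by (auto simp: set_zip)
      then have "rs ! k \<in> I" "js ! k \<in> D" using len sets nth_mem by metis+
      with D I have "1 \<le> js ! k" "rs ! k \<le> int n" by auto
      with k le[OF k(2)] show "1 \<le> snd p \<and> snd p \<le> fst p \<and> fst p \<le> int n" by simp
    qed
  qed
  moreover have "snd ` set (zip rs js) = D" "fst ` set (zip rs js) = I"
    using len sets by (metis list.set_map map_snd_zip, metis list.set_map map_fst_zip)
  ultimately show thesis by (rule that)
qed

theorem bij_betw_fully_comm:
  "bij_betw (\<lambda>w. (J_set n w, I_set n w)) (fully_comm n) (admissible n)"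
proof (rule bij_betwI')
  fix v w assume "v \<in> fully_comm n" "w \<in> fully_comm n"
  then obtain ps qs where ps: "run_pairs n ps" "v = simple_prod (runs ps)"
    and qs: "run_pairs n qs" "w = simple_prod (runs qs)" by (auto simp: fully_comm_iff_runs)
  show "((J_set n v, I_set n v) = (J_set n w, I_set n w)) = (v = w)"
  proof
    assume "(J_set n v, I_set n v) = (J_set n w, I_set n w)"
    then have "set (map fst ps) = set (map fst qs)" "set (map snd ps) = set (map snd qs)"
      using I_J_set_runs[OF ps(1)] I_J_set_runs[OF qs(1)] ps(2) qs(2) by auto
    then have "map fst ps = map fst qs" "map snd ps = map snd qs"
      using run_pairs_sorted[OF ps(1)] run_pairs_sorted[OF qs(1)] by (auto intro: strict_sorted_equal)
    then have "ps = qs" by (metis zip_map_fst_snd)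
    then show "v = w" using ps qs by simp
  qed simp
next
  fix w assume "w \<in> fully_comm n"
  then obtain ps where ps: "run_pairs n ps" "w = simple_prod (runs ps)"
    by (auto simp: fully_comm_iff_runs)
  have perm: "w permutes {1..int n + 1}"
    unfolding ps(2) using set_runs[OF ps(1)] by (rule simple_prod_permutes)
  have "dominates (w ` excedances w) (excedances w)"
    using finite_excedances[OF perm] permutes_inj_on[OF perm]
    by (intro dominates_if_bij) (auto simp: excedances_def)
  moreover have "w ` excedances w = shift (fst ` set ps) 1" "excedances w = snd ` set ps"
    using excedances_runs[OF ps(1)] ps(2) by (simp_all add: shift_eq_image image_image)
  ultimately have "dominates (shift (fst ` set ps) 1) (snd ` set ps)" by simp
  moreover have "fst ` set ps \<subseteq> {1..int n}" "snd ` set ps \<subseteq> {1..int n}"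
    using ps(1) by (force simp: run_pairs_def)+
  ultimately show "(J_set n w, I_set n w) \<in> admissible n"
    using I_J_set_runs[OF ps(1)] ps(2) by (simp add: admissible_def)
next
  fix P assume "P \<in> admissible n"
  then obtain ps where "run_pairs n ps" "P = (snd ` set ps, fst ` set ps)"
    using run_pairs_exist by (metis surj_pair)
  then show "\<exists>w\<in>fully_comm n. P = (J_set n w, I_set n w)"
    using I_J_set_runs by (intro bexI[of _ "simple_prod (runs ps)"]) (auto simp: fully_comm_iff_runs)
qed

lemma shift_shift: "shift (shift A a) b = shift A (a + b)"
  by (simp add: shift_eq_image image_image add.assoc)

lemma shift_0 [simp]: "shift A 0 = A"
  by (simp add: shift_eq_image)

lemma shift_eq_iff: "shift A (- 1) = B \<longleftrightarrow> A = shift B 1"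
  using shift_shift[of A "- 1" 1] shift_shift[of B 1 "- 1"] by auto

theorem bij_betw_NC:
  "bij_betw (\<lambda>x. (D_set x, shift (U_set x) (-1))) (NC n) (admissible n)"
proof -
  have DU: "D_set x = excedances x" "U_set x = x ` excedances x"
    "dominates (x ` excedances x) (excedances x)"
    "excedances x \<subseteq> {1..int n}" "x ` excedances x \<subseteq> {2..int n + 1}" if "x \<in> NC n" for x
  proof -
    from that have perm: "x permutes {1..int n + 1}" and inc: "increasing_cycles {1..int n + 1} x"
      by (auto simp: NC_iff_increasing_cycles)
    show "D_set x = excedances x" "U_set x = x ` excedances x"
      using D_U_set_eq[OF _ perm inc] by simp_all
    show "dominates (x ` excedances x) (excedances x)"
      using finite_excedances[OF perm] permutes_inj_on[OF perm]
      by (intro dominates_if_bij) (auto simp: excedances_def)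
    show "excedances x \<subseteq> {1..int n}" "x ` excedances x \<subseteq> {2..int n + 1}"
      using excedances_subset[OF perm] by blast+
  qed
  show ?thesis
  proof (rule bij_betwI')
    fix x y assume x: "x \<in> NC n" and y: "y \<in> NC n"
    show "((D_set x, shift (U_set x) (-1)) = (D_set y, shift (U_set y) (-1))) = (x = y)"
    proof
      assume "(D_set x, shift (U_set x) (-1)) = (D_set y, shift (U_set y) (-1))"
      then have "excedances y = excedances x" "y ` excedances y = x ` excedances x"
        using DU(1,2)[OF x] DU(1,2)[OF y] shift_eq_iff by (auto simp: shift_shift)
      with x y show "x = y" using NC_unique_from_excedances[OF DU(3-5)[OF x]] by metis
    qed simp
  next
    fix x assume x: "x \<in> NC n"
    have "shift (x ` excedances x) (-1) \<subseteq> {1..int n}"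
      using DU(5)[OF x] by (force simp: shift_eq_image)
    then show "(D_set x, shift (U_set x) (-1)) \<in> admissible n"
      using DU(3,4)[OF x] by (simp add: admissible_def DU(1,2)[OF x] shift_shift)
  next
    fix P assume "P \<in> admissible n"
    then obtain D I where P: "P = (D, I)" "D \<subseteq> {1..int n}" "I \<subseteq> {1..int n}" "dominates (shift I 1) D"
      by (auto simp: admissible_def)
    have "shift I 1 \<subseteq> {2..int n + 1}" using P(3) by (force simp: shift_eq_image)
    from ex1_implies_ex[OF NC_unique_from_excedances[OF P(4,2) this]]
    obtain x where x: "x \<in> NC n" "excedances x = D" "x ` excedances x = shift I 1" by blast
    have "P = (D_set x, shift (U_set x) (-1))"
      unfolding DU(1,2)[OF x(1)] x(3) unfolding x(2) P(1) by (simp add: shift_shift)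
    with x(1) show "\<exists>x\<in>NC n. P = (D_set x, shift (U_set x) (-1))" by blast
  qed
qed

theorem theorem2p12:
  fixes n :: nat
  assumes "n \<ge> 1"
  shows "\<exists>\<phi> \<psi>.
    bij_betw \<phi> (NC n) (fully_comm n) \<and>
    (\<forall>x\<in>NC n. (J_set n (\<phi> x), I_set n (\<phi> x)) = (D_set x, shift (U_set x) (-1))) \<and>
    (\<forall>\<phi>' \<in> NC n \<rightarrow> fully_comm n.
       (\<forall>x\<in>NC n. (J_set n (\<phi>' x), I_set n (\<phi>' x)) = (D_set x, shift (U_set x) (-1))) \<longrightarrow>
       (\<forall>x\<in>NC n. \<phi>' x = \<phi> x)) \<and>
    bij_betw \<psi> (fully_comm n) (NC n) \<and>
    (\<forall>x\<in>NC n. \<psi> (\<phi> x) = x) \<and> (\<forall>w\<in>fully_comm n. \<phi> (\<psi> w) = w) \<and>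
    (\<forall>w\<in>fully_comm n. (D_set (\<psi> w), U_set (\<psi> w)) = (J_set n w, shift (I_set n w) 1)) \<and>
    (\<forall>\<psi>' \<in> fully_comm n \<rightarrow> NC n.
       (\<forall>w\<in>fully_comm n. (D_set (\<psi>' w), U_set (\<psi>' w)) = (J_set n w, shift (I_set n w) 1)) \<longrightarrow>
       (\<forall>w\<in>fully_comm n. \<psi>' w = \<psi> w))"
proof -
  define \<alpha> where "\<alpha> w = (J_set n w, I_set n w)" for w
  define \<beta> where "\<beta> x = (D_set x, shift (U_set x) (-1))" for x
  have \<alpha>: "bij_betw \<alpha> (fully_comm n) (admissible n)"
    using bij_betw_fully_comm[of n] by (simp only: \<alpha>_def[abs_def])
  have \<beta>: "bij_betw \<beta> (NC n) (admissible n)"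
    using bij_betw_NC[of n] by (simp only: \<beta>_def[abs_def])
  define \<phi> where "\<phi> = inv_into (fully_comm n) \<alpha> \<circ> \<beta>"
  define \<psi> where "\<psi> = inv_into (NC n) \<beta> \<circ> \<alpha>"
  have bij_\<phi>: "bij_betw \<phi> (NC n) (fully_comm n)"
    unfolding \<phi>_def by (rule bij_betw_trans[OF \<beta> bij_betw_inv_into[OF \<alpha>]])
  have bij_\<psi>: "bij_betw \<psi> (fully_comm n) (NC n)"
    unfolding \<psi>_def by (rule bij_betw_trans[OF \<alpha> bij_betw_inv_into[OF \<beta>]])
  have \<phi>_in: "\<phi> x \<in> fully_comm n" if "x \<in> NC n" for x
    using bij_betwE[OF bij_\<phi>] that by blast
  have \<psi>_in: "\<psi> w \<in> NC n" if "w \<in> fully_comm n" for w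
    using bij_betwE[OF bij_\<psi>] that by blast
  have \<alpha>\<phi>: "\<alpha> (\<phi> x) = \<beta> x" if "x \<in> NC n" for x
    using bij_betw_inv_into_right[OF \<alpha>] bij_betwE[OF \<beta>] that by (simp add: \<phi>_def)
  have \<beta>\<psi>: "\<beta> (\<psi> w) = \<alpha> w" if "w \<in> fully_comm n" for w
    using bij_betw_inv_into_right[OF \<beta>] bij_betwE[OF \<alpha>] that by (simp add: \<psi>_def)
  have \<alpha>_inj: "v = w" if "v \<in> fully_comm n" "w \<in> fully_comm n" "\<alpha> v = \<alpha> w" for v w
    using inj_onD[OF bij_betw_imp_inj_on[OF \<alpha>] that(3,1,2)] .
  have \<beta>_inj: "x = y" if "x \<in> NC n" "y \<in> NC n" "\<beta> x = \<beta> y" for x y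
    using inj_onD[OF bij_betw_imp_inj_on[OF \<beta>] that(3,1,2)] .
  have swap: "(D_set x, U_set x) = (J_set n w, shift (I_set n w) 1) \<longleftrightarrow> \<beta> x = \<alpha> w" for x w
    by (simp add: \<alpha>_def \<beta>_def shift_eq_iff)
  show ?thesis
    unfolding swap unfolding \<alpha>_def[symmetric] \<beta>_def[symmetric]
  proof (rule exI[of _ \<phi>], rule exI[of _ \<psi>], intro conjI ballI impI)
    show "\<psi> (\<phi> x) = x" if "x \<in> NC n" for x
      using that by (intro \<beta>_inj \<psi>_in \<phi>_in) (simp_all add: \<beta>\<psi> \<alpha>\<phi> \<phi>_in)
    show "\<phi> (\<psi> w) = w" if "w \<in> fully_comm n" for w
      using that by (intro \<alpha>_inj \<psi>_in \<phi>_in) (simp_all add: \<beta>\<psi> \<alpha>\<phi> \<psi>_in)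
    show "\<phi>' x = \<phi> x" if "\<phi>' \<in> NC n \<rightarrow> fully_comm n" "\<forall>x\<in>NC n. \<alpha> (\<phi>' x) = \<beta> x" "x \<in> NC n" for \<phi>' x
      using that by (intro \<alpha>_inj \<phi>_in) (auto simp: \<alpha>\<phi>)
    show "\<psi>' w = \<psi> w"
      if "\<psi>' \<in> fully_comm n \<rightarrow> NC n" "\<forall>w\<in>fully_comm n. \<beta> (\<psi>' w) = \<alpha> w" "w \<in> fully_comm n" for \<psi>' w
      using that by (intro \<beta>_inj \<psi>_in) (auto simp: \<beta>\<psi>)
  qed (use bij_\<phi> bij_\<psi> \<alpha>\<phi> \<beta>\<psi> in auto)
qed

end
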